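(* Let $s\in(-1,\infty]$ and let $F$ be a non-degenerate distribution function on $\mathbb{R}$ (i.e. $J(F)\neq\emptyset$); write $a=\inf J(F)$, $b=\sup J(F)$. The following four statements are equivalent. (i) $F$ is bi-$s^*$-concave. (ii) $F$ is continuous on $\mathbb{R}$ and differentiable on $J(F)$ with derivative $f=F'$, and moreover: if $s\le 0$, then for all $x\in J(F)$ and all $t\in\mathbb{R}$, $$F(x+t)\le F(x)\Big(1+s^*\frac{f(x)}{F(x)}t\Big)_+^{1/s^*},\qquad F(x+t)\ge 1-(1-F(x))\Big(1-s^*\frac{f(x)}{1-F(x)}t\Big)_+^{1/s^*};$$ if $s>0$, then for all $x\in J(F)$, $$F(x+t)\le F(x)\Big(1+s^*\frac{f(x)}{F(x)}t\Big)_+^{1/s^*}\ \text{ for } t\in(a-x,\infty),\qquad F(x+t)\ge 1-(1-F(x))\Big(1-s^*\frac{f(x)}{1-F(x)}t\Big)_+^{1/s^*}\ \text{ for } t\in(-\infty,b-x).$$ (For $s=0$ the expressions $(1\pm s^* u t)_+^{1/s^*}$ are to be read as their limits $\exp(\pm u t)$.) (iii) $F$ is continuous on $\mathbb{R}$ and differentiable on $J(F)$ with derivative $f=F'$, such that the $s^*$-hazard function $f/(1-F)^{1-s^*}$ is non-decreasing on $J(F)$ and the reverse $s^*$-hazard function $f/F^{1-s^*}$ is non-increasing on $J(F)$. (iv) $F$ is continuous on $\mathbb{R}$ and differentiable on $J(F)$ with bounded and strictly positive derivative $f=F'$ on $J(F)$; furthermore $f$ is locally Lipschitz-continuous on $J(F)$,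 and its $L^1$-derivative $f'$ (so that $f(y)-f(x)=\int_x^y f'(u)\,du$ for $x,y\in J(F)$) satisfies, for almost every $x\in J(F)$, $$-(1-s^* )\frac{f(x)^2}{1-F(x)}\le f'(x)\le (1-s^* )\frac{f(x)^2}{F(x)},$$ where $1-s^*=1/(1+s)$; equivalently $-\frac{f^2}{1-F}\le (1+s)f'\le \frac{f^2}{F}$ (with $f'=0$ when $s=\infty$).
   Context: For $s\in(-1,\infty]$ let $s^*=s/(1+s)\in(-\infty,1]$ (with $s^*=1$ when $s=\infty$). For a distribution function $F$ on $\mathbb{R}$, $J(F)=\{x\in\mathbb{R}:0<F(x)<1\}$, and $F$ is non-degenerate if $J(F)\ne\emptyset$. Bi-$s^*$-concavity: for $s\in(-1,0)$, $F$ is bi-$s^*$-concave if $x\mapsto F(x)^{s^*}$ and $x\mapsto(1-F(x))^{s^*}$ are convex functions on $\mathbb{R}$, with values in $(-\infty,+\infty]$ under the convention $0^{s^*}=+\infty$; for $s=0$, $F$ is bi-$0$-concave (bi-log-concave) if $x\mapsto\log F(x)$ and $x\mapsto\log(1-F(x))$ are concave functions on $\mathbb{R}$ with values in $[-\infty,0]$ (convention $\log 0=-\infty$); for $s\in(0,\infty]$, $F$ is bi-$s^*$-concave if $x\mapsto F(x)^{s^*}$ is concave on $(\inf J(F),\infty)$ and $x\mapsto(1-F(x))^{s^*}$ is concave on $(-\infty,\sup J(F))$. $y_+=\max\{y,0\}$. *)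

theory Defs
  imports "HOL-Analysis.Analysis"
begin

definition distribution_function :: "(real \<Rightarrow> real) \<Rightarrow> bool" where
  "distribution_function F \<longleftrightarrow>
     mono F \<and> (\<forall>x. continuous (at_right x) F) \<and>
     (F \<longlongrightarrow> 0) at_bot \<and> (F \<longlongrightarrow> 1) at_top"

definition Jset :: "(real \<Rightarrow> real) \<Rightarrow> real set" where
  "Jset F = {x. 0 < F x \<and> F x < 1}"

definition sstar :: "ereal \<Rightarrow> real" where
  "sstar s = (if s = \<infinity> then 1 else real_of_ereal s / (1 + real_of_ereal s))"

definition ereal_convex_fun :: "(real \<Rightarrow> ereal) \<Rightarrow> bool" where
  "ereal_convex_fun g \<longleftrightarrow>
     (\<forall>x y t. 0 < t \<and> t < 1 \<longrightarrow>
        g ((1 - t) * x + t * y) \<le> ereal (1 - t) * g x + ereal t * g y)"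

definition ereal_concave_fun :: "(real \<Rightarrow> ereal) \<Rightarrow> bool" where
  "ereal_concave_fun g \<longleftrightarrow>
     (\<forall>x y t. 0 < t \<and> t < 1 \<longrightarrow>
        ereal (1 - t) * g x + ereal t * g y \<le> g ((1 - t) * x + t * y))"

text \<open>Bi-s*-concavity, by cases s in (-1,0), s = 0, s in (0, infinity].
  Conventions: 0 powr (negative) = +infinity, log 0 = -infinity.\<close>
definition bi_sconcave :: "ereal \<Rightarrow> (real \<Rightarrow> real) \<Rightarrow> bool" where
  "bi_sconcave s F \<longleftrightarrow>
    (if s < 0 then
       ereal_convex_fun (\<lambda>x. if F x = 0 then \<infinity> else ereal (F x powr sstar s)) \<and>
       ereal_convex_fun (\<lambda>x. if 1 - F x = 0 then \<infinity> else ereal ((1 - F x) powr sstar s))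
     else if s = 0 then
       ereal_concave_fun (\<lambda>x. if F x = 0 then -\<infinity> else ereal (ln (F x))) \<and>
       ereal_concave_fun (\<lambda>x. if 1 - F x = 0 then -\<infinity> else ereal (ln (1 - F x)))
     else
       concave_on {x. Inf (ereal ` Jset F) < ereal x} (\<lambda>x. F x powr sstar s) \<and>
       concave_on {x. ereal x < Sup (ereal ` Jset F)} (\<lambda>x. (1 - F x) powr sstar s))"

text \<open>gpow r v = (1 + r v)_+^(1/r) for r \<noteq> 0 (with 0^(negative) = +infinity),
  and its limit exp v for r = 0.\<close>
definition gpow :: "real \<Rightarrow> real \<Rightarrow> ereal" where
  "gpow r v = (if r = 0 then ereal (exp v)
               else if 0 < 1 + r * v then ereal ((1 + r * v) powr (1 / r))
               else if r < 0 then \<infinity> else 0)"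

end

theory Submission
  imports Defs
begin

text \<open>
  All cases of s are treated at once through the Box-Cox transform (u^r - 1)/r with r = s* (ln for r = 0),
  an increasing concave function with derivative u^(r - 1): F is bi-s*-concave iff the transforms of
  both F and 1 - F are concave. Supergradients of the two concave functions
  touch F from above and from below, so F is differentiable on J(F). The Box-Cox transform of F has
  derivative f / F^(1 - s*), so (ii) says that its tangents lie above it and (iii) that its
  derivative is monotone; every step is carried out for a function W that stands for F or for 1 - F.

  For (iv), monotonicity of the two hazard functions bounds the increments of f from both sides, so f is
  locally Lipschitz. A Lipschitz function plus a linear one is a Stieltjes function whose measure
  is dominated by Lebesgue measure, and Radon-Nikodym gives the L1-derivative; by Lebesgue's
  differentiation theorem it is almost everywhere the right derivative of f, so its bounds come from
  differentiating the hazard functions from the right. Conversely, the integrated bounds on f'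
  make the right slopes of f / F^(1 - s*) non-positive and those of f / (1 - F)^(1 - s*) non-negative.
\<close>

subsection \<open>The L1-derivative of a Lipschitz function\<close>

text \<open>Continuity of G makes single points null, so open and closed intervals have the same
  measure. Open intervals are the sets on which \<open>lborel_eqI\<close> recognises Lebesgue
  measure.\<close>

lemma emeasure_interval_measure_Ioo_cont:
  fixes G :: "real \<Rightarrow> real"
  assumes "l \<le> u" and mono: "\<And>x y. x \<le> y \<Longrightarrow> G x \<le> G y" and cont: "continuous_on UNIV G"
  shows "emeasure (interval_measure G) {l<..<u} = ennreal (G u - G l)"
proof -
  let ?M = "interval_measure G"
  have null: "emeasure ?M {x} = 0" for x
    using emeasure_interval_measure_Icc[OF order_refl mono cont, of x] by simp
  show ?thesis
  proof (cases "l = u")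
    case False
    have "emeasure ?M {l..u} = ennreal (G u - G l)"
      using emeasure_interval_measure_Icc[OF \<open>l \<le> u\<close> mono cont] .
    moreover have "{l..u} = {l<..<u} \<union> ({l} \<union> {u})"
      using assms(1) by auto
    moreover have "{l} \<union> {u} \<in> null_sets ?M"
      by (intro null_sets.Un) (auto simp: null_sets_def null)
    then have "emeasure ?M ({l<..<u} \<union> ({l} \<union> {u})) = emeasure ?M {l<..<u}"
      by (intro emeasure_Un_null_set) auto
    ultimately show ?thesis by simp
  qed simp
qed

text \<open>Because G + H is the identity, the sum of the two Stieltjes measures gives every
  interval its length. The sum is therefore Lebesgue measure, which dominates each summand.\<close>

lemma interval_measure_le_lborel:
  fixes G H :: "real \<Rightarrow> real"
  assumes "mono G" "mono H" "continuous_on UNIV G" "continuous_on UNIV H"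
    and sum: "\<And>x. G x + H x = x"
    and A: "A \<in> sets borel"
  shows "emeasure (interval_measure G) A \<le> emeasure lborel A"
proof -
  let ?S = "\<lambda>A. emeasure (interval_measure G) A + emeasure (interval_measure H) A"
  define M where "M = measure_of UNIV (sets borel :: real set set) ?S"
  have ms: "measure_space UNIV (sets borel) ?S"
    unfolding measure_space_def
  proof (intro conjI)
    show "sigma_algebra UNIV (sets borel :: real set set)"
      using sets.sigma_algebra_axioms[of "borel :: real measure"] by simp
    show "positive (sets borel) ?S"
      by (simp add: positive_def)
    show "countably_additive (sets borel) ?S"
    proof (rule countably_additiveI)
      fix B :: "nat \<Rightarrow> real set"
      assume B: "range B \<subseteq> sets borel" "disjoint_family B" "\<Union> (range B) \<in> sets borel"
      show "(\<Sum>i. ?S (B i)) = ?S (\<Union> (range B))"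
        using B by (simp add: suminf_add[symmetric] suminf_emeasure)
    qed
  qed
  have sets_M: "sets M = sets borel"
    using sets.sigma_sets_eq[of "borel :: real measure"] by (simp add: M_def sets_measure_of_conv)
  have em: "emeasure M B = ?S B" if "B \<in> sets borel" for B
    using ms that by (intro emeasure_measure_of[OF M_def]) (auto simp: measure_space_def sets_M)
  have "lborel = M"
  proof (rule lborel_eqI)
    fix l u :: real
    assume "\<And>b. b \<in> Basis \<Longrightarrow> l \<bullet> b \<le> u \<bullet> b"
    then have lu: "l \<le> u" by simp
    have "emeasure M {l<..<u} = ennreal (G u - G l) + ennreal (H u - H l)"
      using assms lu by (simp add: em emeasure_interval_measure_Ioo_cont monoD)
    also have "\<dots> = ennreal (u - l)"
      using lu sum[of u] sum[of l] monoD[OF assms(1) lu] monoD[OF assms(2) lu]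
      by (simp add: ennreal_plus[symmetric] del: ennreal_plus)
    finally show "emeasure M (box l u) = (\<Prod>b\<in>Basis. (u - l) \<bullet> b)"
      by (simp add: box_real)
  qed (rule sets_M)
  then have "emeasure lborel A = ?S A"
    using em[OF A] by simp
  then show ?thesis by simp
qed

text \<open>For K >= L the functions G = (x + f/K)/2 and H = (x - f/K)/2 are nondecreasing and add
  up to x, so the measure of G is dominated by Lebesgue measure and has a density h. Since f = K (2
  G - x), the function 2 K h - K is a density for f.\<close>

lemma lipschitz_has_integral_density:
  fixes f :: "real \<Rightarrow> real"
  assumes "L-lipschitz_on UNIV f"
  obtains g where "\<And>x y. x \<le> y \<Longrightarrow> g absolutely_integrable_on {x..y}"
    "\<And>x y. x \<le> y \<Longrightarrow> integral {x..y} g = f y - f x"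
proof -
  \<comment> \<open>The summand 1 keeps the divisor K positive when L = 0.\<close>
  define K where "K = L + 1"
  have K: "K > 0" "L \<le> K" using lipschitz_on_nonneg[OF assms] by (auto simp: K_def)
  have lip: "\<bar>f y - f x\<bar> \<le> K * \<bar>y - x\<bar>" for x y
    using lipschitz_onD[OF assms, of y x] K mult_right_mono[OF K(2), of "\<bar>y - x\<bar>"]
    by (simp add: dist_real_def)
  define G where "G = (\<lambda>x. (x + f x / K) / 2)"
  define H where "H = (\<lambda>x. (x - f x / K) / 2)"
  have q: "\<bar>f y / K - f x / K\<bar> \<le> y - x" if "x \<le> y" for x y
  proof -
    have "\<bar>f y / K - f x / K\<bar> = \<bar>f y - f x\<bar> / K"
      using K by (simp add: diff_divide_distrib[symmetric])
    also have "\<dots> \<le> y - x" using lip[of y x] K that by (simp add: field_simps)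
    finally show ?thesis .
  qed
  have mono: "mono G" "mono H"
  proof -
    have aux: "\<bar>v - u\<bar> \<le> y - x \<Longrightarrow> (x + u) / 2 \<le> (y + v) / 2 \<and> (x - u) / 2 \<le> (y - v) / 2"
      for u v x y :: real
      unfolding abs_le_iff by (intro conjI; elim conjE; argo)
    show "mono G" "mono H"
      unfolding G_def H_def by (rule monoI, use aux[OF q] in blast)+
  qed
  have contf: "continuous_on UNIV f"
    by (rule lipschitz_on_continuous_on[OF assms])
  have cont: "continuous_on UNIV G" "continuous_on UNIV H"
    unfolding G_def H_def by (intro continuous_intros contf; use K in simp)+
  let ?M = "interval_measure G"
  have le: "emeasure ?M A \<le> emeasure lborel A" if "A \<in> sets borel" for A
    by (rule interval_measure_le_lborel[OF mono cont _ that]) (simp add: G_def H_def field_simps)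
  have "absolutely_continuous lborel ?M"
    unfolding absolutely_continuous_def
  proof
    fix A :: "real set" assume A: "A \<in> null_sets lborel"
    then show "A \<in> null_sets ?M"
      using le[of A] by (auto simp: null_sets_def)
  qed
  then obtain g where g: "g \<in> borel_measurable lborel" "density lborel g = ?M"
    using sigma_finite_measure.Radon_Nikodym[OF lborel.sigma_finite_measure_axioms, of ?M] by auto
  have nn: "(\<integral>\<^sup>+z. g z * indicator {x..y} z \<partial>lborel) = ennreal (G y - G x)" if "x \<le> y" for x y
  proof -
    have "emeasure ?M {x..y} = (\<integral>\<^sup>+z. g z * indicator {x..y} z \<partial>lborel)"
      unfolding g(2)[symmetric] by (rule emeasure_density) (use g in auto)
    then show ?thesis
      using emeasure_interval_measure_Icc[OF that monoD[OF mono(1)] cont(1)] by simp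
  qed
  \<comment> \<open>The integral of g over a bounded interval is finite, so g is finite almost
    everywhere there and the passage to real values changes no integral.\<close>
  define h where "h = (\<lambda>z. enn2real (g z))"
  have hm[measurable]: "h \<in> borel_measurable borel"
    using g by (auto simp: h_def)
  have hint: "(h has_integral (G y - G x)) {x..y}" and habs: "h absolutely_integrable_on {x..y}"
    if xy: "x \<le> y" for x y
  proof -
    have fin: "AE z in lborel. g z * indicator {x..y} z \<noteq> \<infinity>"
      using nn[OF xy] g by (intro nn_integral_PInf_AE) auto
    have hb: "has_bochner_integral lborel (\<lambda>z. h z * indicator {x..y} z) (G y - G x)"
    proof (rule has_bochner_integral_nn_integral)
      have "(\<integral>\<^sup>+z. ennreal (h z * indicator {x..y} z) \<partial>lborel)
          = (\<integral>\<^sup>+z. g z * indicator {x..y} z \<partial>lborel)"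
        using fin by (intro nn_integral_cong_AE) 
          (auto elim!: eventually_mono simp: h_def less_top indicator_def)
      then show "(\<integral>\<^sup>+z. ennreal (h z * indicator {x..y} z) \<partial>lborel) = ennreal (G y - G x)"
        using nn[OF xy] by simp
      show "0 \<le> G y - G x" using monoD[OF mono(1) xy] by simp
      show "(\<lambda>z. h z * indicator {x..y} z) \<in> borel_measurable lborel" by measurable
    qed (simp add: h_def)
    then have si: "set_integrable lborel {x..y} h"
      by (auto simp: set_integrable_def has_bochner_integral_iff mult.commute)
    have sl: "(LINT z:{x..y}|lborel. h z) = G y - G x"
      using hb by (auto simp: set_lebesgue_integral_def has_bochner_integral_iff mult.commute)
    show "(h has_integral (G y - G x)) {x..y}"
      using has_integral_set_lebesgue[of "{x..y}" h] has_integral_integral set_borel_integral_eq_integral[OF si] sl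
      by metis
    show "h absolutely_integrable_on {x..y}"
      using si unfolding set_integrable_def by (intro integrable_completion[THEN iffD2]) auto
  qed
  let ?h = "\<lambda>z. 2 * K * h z - K"
  show thesis
  proof
    fix x y :: real assume xy: "x \<le> y"
    have "((\<lambda>z. 2 * K * h z - K) has_integral (2 * K * (G y - G x) - K * (y - x))) {x..y}"
      using has_integral_mult_right[OF hint[OF xy], of "2*K"] has_integral_const_real[of K x y] xy
      by (intro has_integral_diff) (auto simp: mult.commute)
    moreover have "2 * K * (G y - G x) - K * (y - x) = f y - f x"
      using K by (simp add: G_def field_simps)
    ultimately show "integral {x..y} ?h = f y - f x"
      by (simp add: integral_unique)
    show "?h absolutely_integrable_on {x..y}"
      using habs[OF xy] by (intro set_integral_diff absolutely_integrable_on_const 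
        set_integrable_mult_right) auto
  qed
qed

lemma has_real_derivative_at_right_unique:
  assumes "(f has_real_derivative D) (at_right x)" "(f has_real_derivative E) (at_right x)"
  shows "D = E"
  using assms unfolding has_field_derivative_iff
  by (rule tendsto_unique[OF trivial_limit_at_right_real])

text \<open>Composing f with the projection onto {c..d} extends it to the line with the same
  Lipschitz constant, which reduces the claim to the global density.\<close>

lemma lipschitz_on_interval_density:
  fixes f :: "real \<Rightarrow> real"
  assumes lip: "L-lipschitz_on {c..d} f" and "c \<le> d"
  obtains N g where "negligible N" "g absolutely_integrable_on {c..d}"
    "\<And>x y. c \<le> x \<Longrightarrow> x \<le> y \<Longrightarrow> y \<le> d \<Longrightarrow> integral {x..y} g = f y - f x"
    "\<And>x. c \<le> x \<Longrightarrow> x < d \<Longrightarrow> x \<notin> N \<Longrightarrow> (f has_real_derivative g x) (at_right x)"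
proof -
  define p where "p = (\<lambda>x. max c (min d x))"
  have p: "p x \<in> {c..d}" "x \<in> {c..d} \<Longrightarrow> p x = x" "\<bar>p x - p y\<bar> \<le> \<bar>x - y\<bar>" for x y
    using \<open>c \<le> d\<close> by (auto simp: p_def max_def min_def)
  have "L-lipschitz_on UNIV (f \<circ> p)"
  proof (rule lipschitz_onI)
    fix x y :: real
    have "dist (f (p x)) (f (p y)) \<le> L * dist (p x) (p y)"
      using lipschitz_onD[OF lip p(1) p(1)] .
    also have "\<dots> \<le> L * dist x y"
      using p(3)[of x y] lipschitz_on_nonneg[OF lip] by (simp add: dist_real_def mult_left_mono)
    finally show "dist ((f \<circ> p) x) ((f \<circ> p) y) \<le> L * dist x y" by simp
  qed (rule lipschitz_on_nonneg[OF lip])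
  from lipschitz_has_integral_density[OF this]
  obtain g where g: "\<And>x y. x \<le> y \<Longrightarrow> g absolutely_integrable_on {x..y}"
    "\<And>x y. x \<le> y \<Longrightarrow> integral {x..y} g = f (p y) - f (p x)"
    unfolding comp_apply by blast
  have *: "g integrable_on cbox a b" for a b
    using set_lebesgue_integral_eq_integral(1)[OF g(1)[of a b]] by (cases "a \<le> b") auto
  \<comment> \<open>This is Lebesgue's differentiation theorem for averages over {x..x+h} with h >
    0, which is why the derivative obtained is one from the right.\<close>
  obtain N where N: "negligible N"
    "\<And>x e. x \<notin> N \<Longrightarrow> 0 < e \<Longrightarrow> \<exists>d>0. \<forall>h. 0 < h \<and> h < d \<longrightarrow>
       norm (integral (cbox x (x + h *\<^sub>R One)) g /\<^sub>R h ^ DIM(real) - g x) < e"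
    using integrable_ccontinuous_explicit[OF *] by blast
  show thesis
  proof
    show "negligible N" "g absolutely_integrable_on {c..d}" using N g \<open>c \<le> d\<close> by auto
    show "integral {x..y} g = f y - f x" if "c \<le> x" "x \<le> y" "y \<le> d" for x y
      using g(2)[of x y] p(2) that by auto
    fix x assume x: "c \<le> x" "x < d" "x \<notin> N"
    have "((\<lambda>y. (f y - f x) / (y - x)) \<longlongrightarrow> g x) (at_right x)"
    proof (rule tendstoI)
      fix e :: real assume "e > 0"
      then obtain \<delta> where \<delta>: "\<delta> > 0"
        "\<And>h. 0 < h \<Longrightarrow> h < \<delta> \<Longrightarrow> \<bar>integral {x..x+h} g / h - g x\<bar> < e"
        using N(2)[OF x(3), of e] by (auto simp: divide_inverse mult.commute)
      have "dist ((f y - f x) / (y - x)) (g x) < e" if "x < y" "y < min d (x + \<delta>)" for y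
        using \<delta>(2)[of "y - x"] that x g(2)[of x y] p(2)[of x] p(2)[of y] by (simp add: dist_real_def)
      then show "\<forall>\<^sub>F y in at_right x. dist ((f y - f x) / (y - x)) (g x) < e"
        using x \<delta>(1) by (intro eventually_at_rightI[of x "min d (x + \<delta>)"]) auto
    qed
    then show "(f has_real_derivative g x) (at_right x)"
      by (simp add: has_field_derivative_iff)
  qed
qed

text \<open>The densities on different compact intervals have to be merged into one function.
  Choosing f' as the right derivative of f, wherever it exists, makes it independent of the
  interval; by uniqueness of right derivatives it agrees with every such density almost
  everywhere.\<close>

lemma locally_lipschitz_L1_derivative:
  fixes f :: "real \<Rightarrow> real"
  assumes "open J" "is_interval J"
    and lip: "\<And>c d. c \<le> d \<Longrightarrow> {c..d} \<subseteq> J \<Longrightarrow> \<exists>L. L-lipschitz_on {c..d} f"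
  obtains f' where
    "\<And>x y. x \<in> J \<Longrightarrow> y \<in> J \<Longrightarrow> x \<le> y \<Longrightarrow> f' absolutely_integrable_on {x..y} \<and> f y - f x = integral {x..y} f'"
    "AE x in lborel. x \<in> J \<longrightarrow> (f has_real_derivative f' x) (at_right x)"
proof -
  define f' where "f' = (\<lambda>x. SOME D. (f has_real_derivative D) (at_right x))"
  have f'I1: "(f has_real_derivative f' x) (at_right x)" if "(f has_real_derivative D) (at_right x)" for x D
    unfolding f'_def by (rule someI[where P = "\<lambda>D. (f has_real_derivative D) (at_right x)", OF that])
  have f'I2: "f' x = D" if "(f has_real_derivative D) (at_right x)" for x D
    by (rule has_real_derivative_at_right_unique[OF f'I1[OF that] that])
  have ex: "\<exists>N. negligible N \<and> f' absolutely_integrable_on {c..d} \<and> integral {c..d} f' = f d - f c \<and>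
      (\<forall>x\<in>{c..<d} - N. (f has_real_derivative f' x) (at_right x))"
    if cd: "c \<le> d" "{c..d} \<subseteq> J" for c d
  proof -
    obtain L where L: "L-lipschitz_on {c..d} f" using lip[OF cd] by blast
    obtain N g where N: "negligible N"
      and g: "g absolutely_integrable_on {c..d}"
      "\<And>x y. c \<le> x \<Longrightarrow> x \<le> y \<Longrightarrow> y \<le> d \<Longrightarrow> integral {x..y} g = f y - f x"
      "\<And>x. c \<le> x \<Longrightarrow> x < d \<Longrightarrow> x \<notin> N \<Longrightarrow> (f has_real_derivative g x) (at_right x)"
      using lipschitz_on_interval_density[OF L cd(1)] by blast
    have N': "negligible (insert d N)" using N by simp
    have eq: "f' x = g x" if "x \<in> {c..d} - insert d N" for x
      by (rule f'I2, rule g(3)) (use that in auto)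
    have i1: "f' absolutely_integrable_on {c..d}"
      by (rule absolutely_integrable_spike[OF g(1) N' eq])
    have "integral {c..d} f' = integral {c..d} g"
      by (rule integral_spike[OF N']) (rule eq[symmetric])
    then have i2: "integral {c..d} f' = f d - f c"
      using g(2)[OF order_refl cd(1) order_refl] by simp
    have i3: "(f has_real_derivative f' x) (at_right x)" if "x \<in> {c..<d} - N" for x
      by (rule f'I1, rule g(3)) (use that in auto)
    show ?thesis
      by (rule exI[of _ N]) (simp add: N i1 i2 i3 del: Diff_iff)
  qed
  show thesis
  proof
    fix x y assume "x \<in> J" "y \<in> J" "x \<le> y"
    then have "{x..y} \<subseteq> J" using interval_subset_is_interval[OF \<open>is_interval J\<close>, of x y] by simp
    then show "f' absolutely_integrable_on {x..y} \<and> f y - f x = integral {x..y} f'"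
      using ex[OF \<open>x \<le> y\<close>] by auto
  next
    \<comment> \<open>Countably many rational intervals cover the open set J, so their exceptional
      sets together remain null. They need not be Borel, hence the detour through
      \<open>lebesgue\<close>.\<close>
    define S where "S = {(p, q). p \<in> \<rat> \<and> q \<in> \<rat> \<and> p \<le> q \<and> {p..q} \<subseteq> J}"
    have "countable S"
      by (rule countable_subset[of _ "\<rat> \<times> \<rat>"]) (auto simp: S_def countable_rat)
    have "AE x in lebesgue. \<forall>(p, q)\<in>S. x \<in> {p..<q} \<longrightarrow> (f has_real_derivative f' x) (at_right x)"
    proof (subst AE_ball_countable[OF \<open>countable S\<close>], clarify)
      fix p q assume "(p, q) \<in> S"
      then have pq: "p \<le> q" "{p..q} \<subseteq> J" unfolding S_def by blast+
      obtain N where N: "negligible N" "\<forall>x\<in>{p..<q} - N. (f has_real_derivative f' x) (at_right x)"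
        using ex[OF pq] by blast
      show "AE x in lebesgue. x \<in> {p..<q} \<longrightarrow> (f has_real_derivative f' x) (at_right x)"
        using N by (intro AE_I'[of N]) (auto simp: negligible_iff_null_sets)
    qed
    then have "AE x in lborel. \<forall>(p, q)\<in>S. x \<in> {p..<q} \<longrightarrow> (f has_real_derivative f' x) (at_right x)"
      by (simp add: AE_completion_iff)
    then show "AE x in lborel. x \<in> J \<longrightarrow> (f has_real_derivative f' x) (at_right x)"
    proof (rule eventually_mono, intro impI)
      fix x assume *: "\<forall>(p, q)\<in>S. x \<in> {p..<q} \<longrightarrow> (f has_real_derivative f' x) (at_right x)" "x \<in> J"
      obtain e where e: "e > 0" "ball x e \<subseteq> J" using \<open>open J\<close> \<open>x \<in> J\<close> open_contains_ball by blast
      obtain p where p: "p \<in> \<rat>" "x - e < p" "p < x" using Rats_dense_in_real[of "x - e" x] e by auto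
      obtain q where q: "q \<in> \<rat>" "x < q" "q < x + e" using Rats_dense_in_real[of x "x + e"] e by auto
      have "{p..q} \<subseteq> ball x e" using p q by (auto simp: dist_real_def)
      then have "{p..q} \<subseteq> J" using e by blast
      then have "(p, q) \<in> S" using p q by (simp add: S_def)
      then show "(f has_real_derivative f' x) (at_right x)" using *(1) p q by auto
    qed
  qed
qed

subsection \<open>The Box-Cox transform and bi-concavity\<close>

text \<open>The normalisation makes the derivative u^(r - 1) for every r; division by a negative r
  also turns convexity of u^r into concavity. For r <= 0 the value at u = 0 is a default and not
  -infinity, so statements about it are restricted to positive arguments.\<close>

definition box_cox :: "real \<Rightarrow> real \<Rightarrow> real" where
  "box_cox r u = (if r = 0 then ln u else (u powr r - 1) / r)"

lemma box_cox_1 [simp]: "box_cox r 1 = 0"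
  by (simp add: box_cox_def)

lemma has_real_derivative_box_cox:
  assumes "u > 0"
  shows "(box_cox r has_real_derivative u powr (r - 1)) (at u)"
proof (cases "r = 0")
  case True
  then show ?thesis
    using DERIV_ln_divide[OF assms] assms
    by (simp add: box_cox_def[abs_def] powr_minus divide_inverse)
next
  case False
  then show ?thesis
    unfolding box_cox_def[abs_def] using assms by (auto intro!: derivative_eq_intros)
qed

lemma DERIV_box_cox_chain:
  assumes "(g has_real_derivative D) (at x within S)" "g x > 0"
  shows "((\<lambda>x. box_cox r (g x)) has_real_derivative D * g x powr (r - 1)) (at x within S)"
  using DERIV_chain2[OF has_real_derivative_box_cox[OF assms(2)] assms(1)]
  by (simp add: mult.commute)

lemma box_cox_less: "0 < u \<Longrightarrow> u < v \<Longrightarrow> box_cox r u < box_cox r v"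
proof (rule DERIV_pos_imp_increasing[where f = "box_cox r"])
  fix x assume "0 < u" "u \<le> x"
  then have "0 < x" by simp
  then show "\<exists>y. (box_cox r has_real_derivative y) (at x) \<and> 0 < y"
    by (intro exI conjI, rule has_real_derivative_box_cox) auto
qed

lemma box_cox_le_iff: "0 < u \<Longrightarrow> 0 < v \<Longrightarrow> box_cox r u \<le> box_cox r v \<longleftrightarrow> u \<le> v"
  using box_cox_less[of u v r] box_cox_less[of v u r] by (cases u v rule: linorder_cases) auto

definition box_cox_inv :: "real \<Rightarrow> real \<Rightarrow> real" where
  "box_cox_inv r v = (if r = 0 then exp v else (1 + r * v) powr (1 / r))"

lemma box_cox_inv_box_cox: "u > 0 \<Longrightarrow> box_cox_inv r (box_cox r u) = u"
  by (simp add: box_cox_inv_def box_cox_def powr_powr)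

lemma box_cox_domain: "u > 0 \<Longrightarrow> 0 < 1 + r * box_cox r u"
  by (simp add: box_cox_def)

lemma box_cox_box_cox_inv: "0 < 1 + r * v \<Longrightarrow> box_cox r (box_cox_inv r v) = v"
  by (simp add: box_cox_inv_def box_cox_def powr_powr)

lemma box_cox_inv_pos: "0 < 1 + r * v \<Longrightarrow> 0 < box_cox_inv r v"
  by (simp add: box_cox_inv_def)

lemma has_real_derivative_box_cox_inv:
  assumes "0 < 1 + r * v"
  obtains D where "(box_cox_inv r has_real_derivative D) (at v)"
proof (cases "r = 0")
  case True
  then show ?thesis
    using that[of "exp v"] DERIV_exp[of v] by (simp add: box_cox_inv_def[abs_def])
next
  case False
  have "\<exists>D. ((\<lambda>v. (1 + r * v) powr (1 / r)) has_real_derivative D) (at v)"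
    using assms by (intro exI) (auto intro!: derivative_eq_intros)
  then show ?thesis
    using that False by (auto simp: box_cox_inv_def[abs_def])
qed

text \<open>Applying the increasing transform to both sides turns the truncated-power bound into a
  tangent-line bound: c u^(r - 1) is the derivative of \<open>box_cox r (W x)\<close> when W x = u
  and W' x = c. For w = 0 the left side holds since \<open>gpow\<close> is nonnegative.\<close>

lemma le_mult_gpow_iff:
  assumes "0 < u" "0 \<le> w" "0 < r \<Longrightarrow> 0 < w"
  shows "ereal w \<le> ereal u * gpow r (c / u * t) \<longleftrightarrow>
    (0 < w \<longrightarrow> box_cox r w \<le> box_cox r u + c * u powr (r - 1) * t)"
proof -
  define v where "v = c / u * t"
  have v: "c * u powr (r - 1) * t = u powr r * v"
    using \<open>0 < u\<close> by (simp add: v_def powr_diff)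
  show ?thesis
  proof (cases "0 < 1 + r * v")
    case True
    define q where "q = u * box_cox_inv r v"
    have q: "q > 0" using box_cox_inv_pos[OF True] \<open>0 < u\<close> by (simp add: q_def)
    have "gpow r v = ereal (box_cox_inv r v)"
      using True by (simp add: gpow_def box_cox_inv_def)
    then have "ereal w \<le> ereal u * gpow r v \<longleftrightarrow> w \<le> q"
      by (simp add: q_def)
    moreover have "box_cox r q = box_cox r u + u powr r * v"
      using True \<open>0 < u\<close>
      by (auto simp: q_def box_cox_def box_cox_inv_def ln_mult powr_mult powr_powr field_simps)
    ultimately show ?thesis
      using box_cox_le_iff[of w q r] q assms(2) unfolding v v_def[symmetric] by auto
  next
    case False
    then have "r \<noteq> 0" by auto
    \<comment> \<open>In the truncated range the line has reached or passed -1/r, the bound that the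
      transform of a positive number never attains. It is an upper bound for r < 0, where
      \<open>gpow\<close> is infinite, and a lower bound for r > 0, where \<open>gpow\<close> is
      0.\<close>
    have le: "u powr r * (1 + r * v) \<le> 0"
      using False \<open>0 < u\<close> by (simp add: mult_nonneg_nonpos)
    have eq: "box_cox r u + u powr r * v = (u powr r * (1 + r * v) - 1) / r"
      using \<open>r \<noteq> 0\<close> by (simp add: box_cox_def field_simps)
    show ?thesis
    proof (cases "r < 0")
      case True
      have "u powr r * (1 + r * v) - 1 \<le> w powr r - 1"
        using le powr_ge_zero[of w r] by linarith
      then have "box_cox r w \<le> box_cox r u + u powr r * v"
        using True unfolding eq by (auto simp: box_cox_def intro: divide_right_mono_neg)
      then show ?thesis
        using True False \<open>0 < u\<close> unfolding v v_def[symmetric] by (simp add: gpow_def)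
    next
      case r: False
      then have w: "0 < w" and "0 < r" using assms(3) \<open>r \<noteq> 0\<close> by auto
      then have "\<not> box_cox r w \<le> box_cox r u + u powr r * v"
        using le powr_gt_zero[of w r] unfolding eq
        by (simp add: box_cox_def divide_le_cancel del: powr_gt_zero)
      then show ?thesis
        using r False w \<open>r \<noteq> 0\<close> unfolding v v_def[symmetric] by (simp add: gpow_def)
    qed
  qed
qed

lemma one_minus_le_ereal_iff: "1 - e \<le> ereal k \<longleftrightarrow> ereal (1 - k) \<le> e"
  by (cases e) (auto simp: one_ereal_def)

section \<open>Concavity of the transform and the extended-real conventions\<close>

lemma concave_on_affine_iff:
  assumes "0 < c"
  shows "concave_on S (\<lambda>x. c * f x + d) \<longleftrightarrow> concave_on S f"
proof -
  have "u * (c * f x + d) + v * (c * f y + d) \<le> c * f z + d \<longleftrightarrow> u * f x + v * f y \<le> f z"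
    if "u + v = 1" for u v x y z
  proof -
    have "u * (c * f x + d) + v * (c * f y + d) = c * (u * f x + v * f y) + (u + v) * d"
      by (simp add: algebra_simps)
    then show ?thesis using that assms by simp
  qed
  then show ?thesis unfolding concave_on_iff by blast
qed

lemma concave_on_box_cox_pos:
  assumes "0 < r"
  shows "concave_on S (\<lambda>x. box_cox r (W x)) \<longleftrightarrow> concave_on S (\<lambda>x. W x powr r)"
  using concave_on_affine_iff[of "1 / r" S "\<lambda>x. W x powr r" "- 1 / r"] assms
  by (simp add: box_cox_def diff_divide_distrib)

lemma concave_on_box_cox_neg:
  assumes "r < 0"
  shows "concave_on S (\<lambda>x. box_cox r (W x)) \<longleftrightarrow> convex_on S (\<lambda>x. W x powr r)"
  using concave_on_affine_iff[of "- 1 / r" S "\<lambda>x. - (W x powr r)" "- 1 / r"] assms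
  by (simp add: box_cox_def diff_divide_distrib concave_on_def)

lemma convex_on_iff_segment:
  fixes S :: "real set"
  shows "convex_on S f \<longleftrightarrow> convex S \<and> (\<forall>x\<in>S. \<forall>y\<in>S. \<forall>t. 0 < t \<and> t < 1 \<longrightarrow>
    f ((1 - t) * x + t * y) \<le> (1 - t) * f x + t * f y)"
  using convex_on_imp_convex[of S f] convex_onD[of S f] convex_onI[of S f]
  by (auto simp: less_imp_le)

text \<open>Both weights are positive, so a point outside S makes the right-hand side infinite and
  only segments with both ends in S impose a condition. This translates the value +infinity at 0
  into convexity on the set where the function is positive.\<close>

lemma ereal_convex_fun_iff:
  fixes g :: "real \<Rightarrow> real"
  assumes "convex S"
  shows "ereal_convex_fun (\<lambda>x. if x \<in> S then ereal (g x) else \<infinity>) \<longleftrightarrow> convex_on S g"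
proof
  assume L: "ereal_convex_fun (\<lambda>x. if x \<in> S then ereal (g x) else \<infinity>)"
  show "convex_on S g"
    unfolding convex_on_iff_segment
  proof (intro conjI assms ballI allI impI)
    fix x y t :: real assume *: "x \<in> S" "y \<in> S" "0 < t \<and> t < 1"
    then have "(1 - t) * x + t * y \<in> S"
      using convexD[OF assms, of x y "1 - t" t] by simp
    then show "g ((1 - t) * x + t * y) \<le> (1 - t) * g x + t * g y"
      using L[unfolded ereal_convex_fun_def, rule_format, of t x y] * by simp
  qed
next
  assume R: "convex_on S g"
  show "ereal_convex_fun (\<lambda>x. if x \<in> S then ereal (g x) else \<infinity>)"
    unfolding ereal_convex_fun_def
  proof (intro allI impI)
    fix x y t :: real assume t: "0 < t \<and> t < 1"
    show "(if (1 - t) * x + t * y \<in> S then ereal (g ((1 - t) * x + t * y)) else \<infinity>)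
      \<le> ereal (1 - t) * (if x \<in> S then ereal (g x) else \<infinity>) + ereal t * (if y \<in> S then ereal (g y) else \<infinity>)"
    proof (cases "x \<in> S \<and> y \<in> S")
      case True
      then have "(1 - t) * x + t * y \<in> S"
        using convexD[OF assms, of x y "1 - t" t] t by simp
      then show ?thesis
        using R[unfolded convex_on_iff_segment] True t by simp
    qed (use t in auto)
  qed
qed

lemma ereal_concave_fun_iff:
  fixes g :: "real \<Rightarrow> real"
  assumes "convex S"
  shows "ereal_concave_fun (\<lambda>x. if x \<in> S then ereal (g x) else -\<infinity>) \<longleftrightarrow> concave_on S g"
proof -
  have "ereal_concave_fun (\<lambda>x. if x \<in> S then ereal (g x) else -\<infinity>) \<longleftrightarrow>
      ereal_convex_fun (\<lambda>x. if x \<in> S then ereal (- g x) else \<infinity>)"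
    unfolding ereal_concave_fun_def ereal_convex_fun_def
    by (intro all_cong1 imp_cong refl) (simp add: algebra_simps)
  then show ?thesis
    using ereal_convex_fun_iff[OF assms, of "\<lambda>x. - g x"] by (simp add: concave_on_def)
qed

lemma sstar_0 [simp]: "sstar 0 = 0"
  by (simp add: sstar_def)

lemma sstar_sgn:
  assumes "-1 < s"
  shows "s < 0 \<Longrightarrow> sstar s < 0" "0 < s \<Longrightarrow> 0 < sstar s" "sstar s \<le> 1"
  using assms by (cases s; auto simp: sstar_def field_simps one_ereal_def zero_ereal_def)+

section \<open>Endpoints of J(F), continuity, and bi-concavity of distribution functions\<close>

lemma distribution_function_bounds:
  assumes "distribution_function F"
  shows "0 \<le> F x" "F x \<le> 1"
proof -
  have m: "mono F" and l: "(F \<longlongrightarrow> 0) at_bot" "(F \<longlongrightarrow> 1) at_top"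
    using assms by (auto simp: distribution_function_def)
  show "0 \<le> F x"
    by (rule tendsto_upperbound[OF l(1)])
      (auto intro!: eventually_mono[OF eventually_le_at_bot[of x]] monoD[OF m])
  show "F x \<le> 1"
    by (rule tendsto_lowerbound[OF l(2)])
      (auto intro!: eventually_mono[OF eventually_ge_at_top[of x]] monoD[OF m])
qed

text \<open>These inclusions are available before continuity is known. If F jumps at a to a value
  below 1, then F is positive at a itself and the first inclusion is strict.\<close>

lemma Jset_endpoints_subset:
  assumes "mono F"
  shows "{x. Inf (ereal ` Jset F) < ereal x} \<subseteq> {x. 0 < F x}"
    and "{x. ereal x < Sup (ereal ` Jset F)} \<subseteq> {x. 0 < 1 - F x}"
proof safe
  fix x assume "Inf (ereal ` Jset F) < ereal x"
  then obtain y where "y \<in> Jset F" "y < x" by (auto simp: Inf_less_iff)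
  then show "0 < F x" using monoD[OF assms, of y x] by (simp add: Jset_def)
next
  fix x assume "ereal x < Sup (ereal ` Jset F)"
  then obtain y where "y \<in> Jset F" "x < y" by (auto simp: less_Sup_iff)
  then show "0 < 1 - F x" using monoD[OF assms, of x y] by (simp add: Jset_def)
qed

text \<open>Continuity makes J(F) open, so a point of J(F) has further points of J(F) on both sides.
  A point with F = 1 lies to the right of all of J(F), one with F = 0 to the left.\<close>

lemma Jset_endpoints:
  assumes "mono F" "continuous_on UNIV F" "Jset F \<noteq> {}"
  shows "{x. Inf (ereal ` Jset F) < ereal x} = {x. 0 < F x}"
    and "{x. ereal x < Sup (ereal ` Jset F)} = {x. 0 < 1 - F x}"
proof -
  have m: "F x < F y \<Longrightarrow> x < y" for x y
    using monoD[OF assms(1), of y x] by (cases "x < y") auto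
  have op: "open (Jset F)"
    unfolding Jset_def using assms(2) by (auto intro!: open_Collect_conj open_Collect_less continuous_intros)
  obtain z where z: "z \<in> Jset F" using assms(3) by blast
  have nb: "\<exists>y\<in>Jset F. y < x" "\<exists>y\<in>Jset F. x < y" if x: "x \<in> Jset F" for x
  proof -
    obtain e where e: "e > 0" "ball x e \<subseteq> Jset F" using op x open_contains_ball by blast
    have "x - e/2 \<in> ball x e" "x + e/2 \<in> ball x e" using e(1) by (auto simp: dist_real_def)
    then have "x - e/2 \<in> Jset F" "x + e/2 \<in> Jset F" using e(2) by blast+
    then show "\<exists>y\<in>Jset F. y < x" "\<exists>y\<in>Jset F. x < y"
      using e(1) by (rule_tac bexI; simp)+
  qed
  show "{x. Inf (ereal ` Jset F) < ereal x} = {x. 0 < F x}"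
  proof (intro equalityI Jset_endpoints_subset(1)[OF assms(1)] subsetI, unfold mem_Collect_eq)
    fix x assume x: "0 < F x"
    have "\<exists>y\<in>Jset F. y < x"
    proof (cases "F x < 1")
      case True then show ?thesis using nb(1)[of x] x by (simp add: Jset_def)
    next
      case False then show ?thesis using z m[of z x] by (intro bexI[of _ z]) (auto simp: Jset_def)
    qed
    then show "Inf (ereal ` Jset F) < ereal x" by (auto simp: Inf_less_iff)
  qed
  show "{x. ereal x < Sup (ereal ` Jset F)} = {x. 0 < 1 - F x}"
  proof (intro equalityI Jset_endpoints_subset(2)[OF assms(1)] subsetI, unfold mem_Collect_eq)
    fix x assume x: "0 < 1 - F x"
    have "\<exists>y\<in>Jset F. x < y"
    proof (cases "0 < F x")
      case True then show ?thesis using nb(2)[of x] x by (simp add: Jset_def)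
    next
      case False then show ?thesis using z m[of x z] by (intro bexI[of _ z]) (auto simp: Jset_def)
    qed
    then show "ereal x < Sup (ereal ` Jset F)" by (auto simp: less_Sup_iff)
  qed
qed

text \<open>A concave function on an open set is continuous, and W is recovered from its transform
  by a continuous inverse.\<close>

lemma continuous_on_of_box_cox:
  assumes "concave_on S (\<lambda>x. box_cox r (W x))" "open S" "\<And>x. x \<in> S \<Longrightarrow> 0 < W x"
  shows "continuous_on S (W :: real \<Rightarrow> real)"
proof -
  have "continuous_on S (\<lambda>x. - (- box_cox r (W x)))"
    using assms(1) unfolding concave_on_def
    by (intro continuous_on_minus convex_on_continuous[OF assms(2)])
  then have c: "continuous_on S (\<lambda>x. box_cox r (W x))" by simp
  have "continuous_on {v. 0 < 1 + r * v} (box_cox_inv r)"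
    by (intro continuous_at_imp_continuous_on ballI)
      (metis DERIV_isCont has_real_derivative_box_cox_inv mem_Collect_eq)
  then have "continuous_on S (\<lambda>x. box_cox_inv r (box_cox r (W x)))"
    by (rule continuous_on_compose2[OF _ c]) (use assms(3) box_cox_domain in auto)
  then show ?thesis
    using assms(3) by (simp add: box_cox_inv_box_cox cong: continuous_on_cong)
qed

text \<open>Concavity gives continuity on (a, infinity) and on (-infinity, b). These half-lines
  cover the real line as soon as J(F) has two points, and right-continuity provides a second one: F
  stays below 1 just to the right of any point of J(F).\<close>

lemma distribution_function_continuous:
  assumes F: "distribution_function F" and J: "Jset F \<noteq> {}"
    and C: "concave_on {x. Inf (ereal ` Jset F) < ereal x} (\<lambda>x. box_cox r (F x))"
      "concave_on {x. ereal x < Sup (ereal ` Jset F)} (\<lambda>x. box_cox r (1 - F x))"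
  shows "continuous_on UNIV F"
proof -
  let ?A = "{x. Inf (ereal ` Jset F) < ereal x}" and ?B = "{x. ereal x < Sup (ereal ` Jset F)}"
  have m: "mono F" and rc: "continuous (at_right x) F" for x
    using F by (auto simp: distribution_function_def)
  have o: "open ?A" "open ?B"
    by (auto intro!: open_Collect_less continuous_intros continuous_on_ereal)
  have "0 < F x" if "x \<in> ?A" for x
    using that Jset_endpoints_subset(1)[OF m] by blast
  then have cA: "continuous_on ?A F"
    using continuous_on_of_box_cox[OF C(1) o(1)] by blast
  have "0 < 1 - F x" if "x \<in> ?B" for x
    using that Jset_endpoints_subset(2)[OF m] by blast
  then have "continuous_on ?B (\<lambda>x. 1 - (1 - F x))"
    by (intro continuous_on_diff continuous_on_const continuous_on_of_box_cox[OF C(2) o(2)])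
  then have cB: "continuous_on ?B F" by simp
  obtain x where x: "x \<in> Jset F" using J by blast
  have "\<forall>\<^sub>F y in at_right x. F y < 1"
    using rc[of x] x by (auto simp: continuous_within Jset_def intro: order_tendstoD)
  then obtain e where "x < e" "\<And>y. x < y \<Longrightarrow> y < e \<Longrightarrow> F y < 1"
    unfolding eventually_at_right_field by blast
  then obtain y where y: "x < y" "F y < 1" using dense by blast
  then have "y \<in> Jset F" using x monoD[OF m, of x y] by (auto simp: Jset_def)
  then have "(\<exists>x\<in>Jset F. x < z) \<or> (\<exists>x\<in>Jset F. z < x)" for z
    using x y(1) by (metis not_less le_less_trans)
  then have "z \<in> ?A \<or> z \<in> ?B" for z
    by (auto simp: Inf_less_iff less_Sup_iff)
  then have "?A \<union> ?B = UNIV" by blast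
  then show ?thesis
    using continuous_on_open_Un[OF o cA cB] by simp
qed

text \<open>For s <= 0 the infinite values restrict the condition to the sets of positivity, whereas
  for s > 0 it is imposed on the half-lines given by a and b. The two kinds of sets are identified
  through continuity, which is therefore derived first and recorded on the right.\<close>

lemma bi_sconcave_iff:
  assumes s: "-1 < s" and F: "distribution_function F" and J: "Jset F \<noteq> {}"
  shows "bi_sconcave s F \<longleftrightarrow> continuous_on UNIV F \<and>
    concave_on {x. 0 < F x} (\<lambda>x. box_cox (sstar s) (F x)) \<and>
    concave_on {x. 0 < 1 - F x} (\<lambda>x. box_cox (sstar s) (1 - F x))"
proof -
  let ?r = "sstar s"
  let ?C = "concave_on {x. 0 < F x} (\<lambda>x. box_cox ?r (F x)) \<and>
    concave_on {x. 0 < 1 - F x} (\<lambda>x. box_cox ?r (1 - F x))"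
  have m: "mono F" using F by (simp add: distribution_function_def)
  have b: "0 \<le> F x" "F x \<le> 1" for x
    using distribution_function_bounds[OF F] by auto
  have cv: "convex {x. 0 < F x}" "convex {x. 0 < 1 - F x}"
    using monoD[OF m] unfolding is_interval_convex_1[symmetric] is_interval_1
    by (auto intro: less_le_trans le_less_trans)
  have set: "(\<lambda>x. if F x = 0 then p else q x) = (\<lambda>x. if x \<in> {x. 0 < F x} then q x else p)"
    "(\<lambda>x. if 1 - F x = 0 then p else q x) = (\<lambda>x. if x \<in> {x. 0 < 1 - F x} then q x else p)"
    for p and q :: "real \<Rightarrow> ereal"
    using b by (auto simp: fun_eq_iff less_le)
  have imp_cont: "continuous_on UNIV F" if ?C
  proof (rule distribution_function_continuous[OF F J])
    have "convex {x. Inf (ereal ` Jset F) < ereal x}" "convex {x. ereal x < Sup (ereal ` Jset F)}"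
      unfolding is_interval_convex_1[symmetric] is_interval_1
      by (auto intro: less_le_trans[of _ "ereal _" "ereal _"] le_less_trans[of "ereal _" "ereal _"])
    then show "concave_on {x. Inf (ereal ` Jset F) < ereal x} (\<lambda>x. box_cox ?r (F x))"
      "concave_on {x. ereal x < Sup (ereal ` Jset F)} (\<lambda>x. box_cox ?r (1 - F x))"
      using that Jset_endpoints_subset[OF m] unfolding concave_on_def by (meson convex_on_subset)+
  qed
  consider "s < 0" | "s = 0" | "0 < s" by fastforce
  then show ?thesis
  proof cases
    case 1
    then have "bi_sconcave s F \<longleftrightarrow> ?C"
      unfolding bi_sconcave_def set ereal_convex_fun_iff[OF cv(1)] ereal_convex_fun_iff[OF cv(2)]
      by (simp add: concave_on_box_cox_neg sstar_sgn(1)[OF s])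
    then show ?thesis using imp_cont by blast
  next
    case 2
    then have "bi_sconcave s F \<longleftrightarrow> ?C"
      unfolding bi_sconcave_def set ereal_concave_fun_iff[OF cv(1)] ereal_concave_fun_iff[OF cv(2)]
      by (simp add: box_cox_def)
    then show ?thesis using imp_cont by blast
  next
    case 3
    then have eq: "bi_sconcave s F \<longleftrightarrow>
        concave_on {x. Inf (ereal ` Jset F) < ereal x} (\<lambda>x. box_cox ?r (F x)) \<and>
        concave_on {x. ereal x < Sup (ereal ` Jset F)} (\<lambda>x. box_cox ?r (1 - F x))"
      unfolding bi_sconcave_def using order_less_not_sym[OF 3] order_less_imp_not_eq2[OF 3]
      by (simp add: concave_on_box_cox_pos sstar_sgn(2)[OF s])
    then have "bi_sconcave s F \<Longrightarrow> continuous_on UNIV F"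
      using distribution_function_continuous[OF F J] by blast
    then show ?thesis
      using eq Jset_endpoints[OF m _ J] by metis
  qed
qed

subsection \<open>One-sided characterisations\<close>

text \<open>A - B has a local minimum at x, so A and B have the same derivative there. The
  difference quotients of g lie between theirs, in an order that depends on the side of x.\<close>

lemma has_real_derivative_sandwich:
  fixes A B g :: "real \<Rightarrow> real"
  assumes A: "(A has_real_derivative a) (at x)" and B: "(B has_real_derivative b) (at x)"
    and eq: "A x = g x" "B x = g x"
    and le: "\<forall>\<^sub>F y in nhds x. B y \<le> g y \<and> g y \<le> A y"
  shows "(g has_real_derivative a) (at x)"
proof -
  obtain d where d: "d > 0" "\<And>y. \<bar>x - y\<bar> < d \<Longrightarrow> B y \<le> g y \<and> g y \<le> A y"
    using le unfolding eventually_nhds_metric by (auto simp: dist_real_def abs_minus_commute)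
  have "a - b = 0"
  proof (rule DERIV_local_min[OF DERIV_diff[OF A B] d(1)], intro allI impI)
    fix y assume "\<bar>x - y\<bar> < d"
    then have "B y \<le> A y" using d(2)[of y] by linarith
    then show "A x - B x \<le> A y - B y" using eq by simp
  qed
  then have B: "(B has_real_derivative a) (at x)" using B by simp
  let ?q = "\<lambda>f y. (f y - f x) / (y - x) - a"
  have "(?q A \<longlongrightarrow> 0) (at x)" "(?q B \<longlongrightarrow> 0) (at x)"
    using A B unfolding has_field_derivative_iff by (auto intro: LIM_zero)
  then have "((\<lambda>y. \<bar>?q A y\<bar> + \<bar>?q B y\<bar>) \<longlongrightarrow> 0) (at x)"
    using tendsto_add[OF tendsto_rabs tendsto_rabs, of _ 0 _ _ 0] by fastforce
  moreover have "\<forall>\<^sub>F y in at x. norm (?q g y) \<le> \<bar>?q A y\<bar> + \<bar>?q B y\<bar>"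
  proof (rule eventually_mono[OF eventually_at_ball'[OF d(1), of x UNIV]])
    fix y assume y: "y \<in> ball x d \<and> y \<noteq> x \<and> y \<in> UNIV"
    then have *: "B y \<le> g y" "g y \<le> A y" using d(2)[of y] by (auto simp: dist_real_def)
    show "norm (?q g y) \<le> \<bar>?q A y\<bar> + \<bar>?q B y\<bar>"
    proof (cases "x < y")
      case True
      then have "?q B y \<le> ?q g y" "?q g y \<le> ?q A y"
        using * eq by (auto intro!: divide_right_mono)
      then show ?thesis by auto
    next
      case False
      then have "y < x" using y by auto
      then have "?q A y \<le> ?q g y" "?q g y \<le> ?q B y"
        using * eq by (auto intro!: divide_right_mono_neg)
      then show ?thesis by auto
    qed
  qed
  ultimately have "(?q g \<longlongrightarrow> 0) (at x)"
    by (rule Lim_null_comparison[rotated])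
  then show ?thesis
    unfolding has_field_derivative_iff by (rule LIM_zero_cancel)
qed

text \<open>A line supporting the concave transform from above at x is carried back by
  \<open>box_cox_inv\<close>. The result is differentiable at x, touches W there, and dominates W
  near x, where the line stays in the domain of the inverse.\<close>

lemma box_cox_concave_upper_touch:
  assumes C: "concave_on S (\<lambda>x. box_cox r (W x))" and S: "open S" "x \<in> S"
    and pos: "\<And>y. y \<in> S \<Longrightarrow> 0 < W y"
  obtains A a where "(A has_real_derivative a) (at x)" "A x = W x" "\<forall>\<^sub>F y in nhds x. W y \<le> A y"
proof -
  define \<phi> where "\<phi> = (\<lambda>x. - box_cox r (W x))"
  have cv: "convex_on S \<phi>" using C by (simp add: concave_on_def \<phi>_def)
  \<comment> \<open>The infimum of the slopes to the right is the right derivative of the convex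
    function, hence a subgradient at x.\<close>
  define c where "c = Inf ((\<lambda>t. (\<phi> x - \<phi> t) / (x - t)) ` ({x<..} \<inter> S))"
  have sup: "\<phi> y \<ge> \<phi> x + c * (y - x)" if "y \<in> S" for y
    using convex_le_Inf_differential[OF cv _ that, of x] S by (simp add: interior_open c_def)
  define l where "l = (\<lambda>y. box_cox r (W x) - c * (y - x))"
  have lx: "0 < 1 + r * l x" using box_cox_domain[OF pos[OF S(2)]] by (simp add: l_def)
  obtain D where D: "(box_cox_inv r has_real_derivative D) (at (l x))"
    using has_real_derivative_box_cox_inv[OF lx] .
  have "(l has_real_derivative - c) (at x)"
    unfolding l_def by (auto intro!: derivative_eq_intros)
  from DERIV_chain2[OF D this]
  have dA: "((\<lambda>y. box_cox_inv r (l y)) has_real_derivative D * - c) (at x)" .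
  have Ax: "box_cox_inv r (l x) = W x"
    using box_cox_inv_box_cox[OF pos[OF S(2)]] by (simp add: l_def)
  have "open {y. 0 < 1 + r * l y}"
    unfolding l_def by (intro open_Collect_less continuous_intros)
  then have "\<forall>\<^sub>F y in nhds x. y \<in> S \<inter> {y. 0 < 1 + r * l y}"
    using S lx by (intro eventually_nhds_in_open) auto
  then have "\<forall>\<^sub>F y in nhds x. W y \<le> box_cox_inv r (l y)"
  proof (rule eventually_mono)
    fix y assume y: "y \<in> S \<inter> {y. 0 < 1 + r * l y}"
    then have "box_cox r (W y) \<le> box_cox r (box_cox_inv r (l y))"
      using sup[of y] by (simp add: box_cox_box_cox_inv \<phi>_def l_def)
    then show "W y \<le> box_cox_inv r (l y)"
      using box_cox_le_iff[OF pos box_cox_inv_pos] y by blast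
  qed
  then show thesis using that dA Ax by blast
qed

text \<open>If g d > g c, subtract a small linear term to get k. The last point m at which k is at
  most g c lies before d, but the slope condition at m with the same e yields a later such
  point.\<close>

lemma nonincreasing_of_right_slopes:
  fixes g :: "real \<Rightarrow> real"
  assumes "c \<le> d" and cont: "continuous_on {c..d} g"
    and slope: "\<And>x e. c \<le> x \<Longrightarrow> x < d \<Longrightarrow> 0 < e \<Longrightarrow> \<forall>\<^sub>F y in at_right x. g y - g x \<le> e * (y - x)"
  shows "g d \<le> g c"
proof (rule ccontr)
  assume "\<not> g d \<le> g c"
  then have "g d > g c" "c < d" using \<open>c \<le> d\<close> by (auto simp: less_le)
  \<comment> \<open>Half the mean slope, so that k still exceeds g c at d.\<close>
  define e where "e = (g d - g c) / 2 / (d - c)"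
  have "X / \<delta> * \<delta> = X" if "\<delta> > 0" for X \<delta> :: real using that by simp
  then have "e * (d - c) = (g d - g c) / 2"
    unfolding e_def using \<open>c < d\<close> by (metis diff_gt_0_iff_gt)
  then have e: "e > 0" "e * (d - c) < g d - g c"
    using \<open>g d > g c\<close> \<open>c < d\<close> by (auto simp: e_def[abs_def])
  define k where "k = (\<lambda>x. g x - e * (x - c))"
  let ?K = "{x\<in>{c..d}. k x \<le> g c}"
  have "closed ?K"
    unfolding k_def by (intro continuous_on_closed_Collect_le continuous_intros cont)
  moreover have "bounded ?K" by (rule bounded_subset[of "{c..d}"]) auto
  ultimately have "compact ?K" by (simp add: compact_eq_bounded_closed)
  moreover have "c \<in> ?K" using \<open>c \<le> d\<close> by (simp add: k_def)
  ultimately obtain m where m: "m \<in> ?K" "\<And>x. x \<in> ?K \<Longrightarrow> x \<le> m"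
    using compact_attains_sup[of ?K] by blast
  have "m \<noteq> d" using m(1) e(2) by (auto simp: k_def)
  then have "c \<le> m" "m < d" using m(1) by auto
  then have "\<forall>\<^sub>F y in at_right m. g y - g m \<le> e * (y - m)"
    using slope e(1) by blast
  then obtain b where b: "m < b" "\<And>y. m < y \<Longrightarrow> y < b \<Longrightarrow> g y - g m \<le> e * (y - m)"
    unfolding eventually_at_right_field by blast
  obtain y where y: "m < y" "y < min b d" using dense[of m "min b d"] b(1) \<open>m < d\<close> by auto
  then have "g y - g m \<le> e * (y - m)" using b(2) by simp
  then have "k y \<le> k m" by (simp add: k_def algebra_simps)
  then have "y \<in> ?K" using m(1) y by auto
  then show False using m(2)[of y] y(1) by simp
qed

section \<open>A single profile W, standing for F or for 1 - F\<close>

text \<open>The assumptions are those that F and 1 - F share: convexity of the two sets takes the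
  place of monotonicity, whose direction differs between them.\<close>

locale bounded_profile =
  fixes r :: real and W w :: "real \<Rightarrow> real"
  assumes r_le_1: "r \<le> 1"
    and cont: "continuous_on UNIV W"
    and bounds: "0 \<le> W x" "W x \<le> 1"
    and convex_pos: "convex {x. 0 < W x}"
    and convex_Jset: "convex (Jset W)"
    and deriv: "x \<in> Jset W \<Longrightarrow> (W has_real_derivative w x) (at x)"
begin

text \<open>For W = F this is the reverse hazard function; for W = 1 - F, where w = -f, it is minus
  the hazard function. It is also the derivative of the transform of W.\<close>

definition rate :: "real \<Rightarrow> real" where
  "rate x = w x / W x powr (1 - r)"

lemma rate_eq: "rate x = w x * W x powr (r - 1)"
  using powr_minus_divide[of "W x" "1 - r"] by (simp add: rate_def)

lemma JsetD: "x \<in> Jset W \<Longrightarrow> 0 < W x" "x \<in> Jset W \<Longrightarrow> W x < 1"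
  by (auto simp: Jset_def)

lemma open_pos: "open {x. 0 < W x}"
  by (intro open_Collect_less continuous_on_const cont)

lemma open_Jset: "open (Jset W)"
  unfolding Jset_def by (intro open_Collect_conj open_Collect_less continuous_on_const cont)

lemma Icc_subset_Jset: "x \<in> Jset W \<Longrightarrow> y \<in> Jset W \<Longrightarrow> {x..y} \<subseteq> Jset W"
  using interval_subset_is_interval[of "Jset W" x y] convex_Jset
  by (simp add: is_interval_convex_1)

lemma deriv_box_cox:
  "x \<in> Jset W \<Longrightarrow> ((\<lambda>x. box_cox r (W x)) has_real_derivative rate x) (at x)"
  using DERIV_box_cox_chain[OF deriv, of x r] JsetD by (simp add: rate_eq)

definition tangent_bound :: bool where
  "tangent_bound \<longleftrightarrow> (\<forall>x\<in>Jset W. \<forall>y. 0 < W y \<longrightarrow>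
     box_cox r (W y) \<le> box_cox r (W x) + rate x * (y - x))"

lemma tangent_boundI:
  assumes "concave_on {x. 0 < W x} (\<lambda>x. box_cox r (W x))"
  shows tangent_bound
  unfolding tangent_bound_def
proof (intro ballI allI impI)
  fix x y assume x: "x \<in> Jset W" and y: "0 < W y"
  let ?\<phi> = "\<lambda>x. - box_cox r (W x)"
  have "?\<phi> y - ?\<phi> x \<ge> - rate x * (y - x)"
  proof (rule convex_on_imp_above_tangent)
    show "convex_on {x. 0 < W x} ?\<phi>" using assms by (simp add: concave_on_def)
    show "connected {x. 0 < W x}" using convex_pos by (rule convex_connected)
    show "x \<in> interior {x. 0 < W x}" using open_pos JsetD[OF x] by (simp add: interior_open)
    show "y \<in> {x. 0 < W x}" using y by simp
    show "(?\<phi> has_real_derivative - rate x) (at x within {x. 0 < W x})"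
      by (intro DERIV_minus has_field_derivative_at_within[OF deriv_box_cox[OF x]])
  qed
  then show "box_cox r (W y) \<le> box_cox r (W x) + rate x * (y - x)" by simp
qed

text \<open>At an intermediate point z with W z < 1 the tangent at z bounds both end values, and its
  linear part cancels in the weighted mean. If W z = 1, the transform takes its maximal value 0 at
  z.\<close>

lemma concave_on_of_tangent_bound:
  assumes tangent_bound
  shows "concave_on {x. 0 < W x} (\<lambda>x. box_cox r (W x))"
  unfolding concave_on_def convex_on_iff_segment
proof (intro conjI convex_pos ballI allI impI)
  fix x y t :: real
  assume x: "x \<in> {x. 0 < W x}" and y: "y \<in> {x. 0 < W x}" and t: "0 < t \<and> t < 1"
  define z where "z = (1 - t) * x + t * y"
  have z: "0 < W z"
    using convexD[OF convex_pos x y, of "1 - t" t] t by (simp add: z_def)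
  have "(1 - t) * box_cox r (W x) + t * box_cox r (W y) \<le> box_cox r (W z)"
  proof (cases "W z = 1")
    case True
    have "box_cox r (W x) \<le> 0" "box_cox r (W y) \<le> 0"
      using box_cox_le_iff[of _ 1 r] x y bounds by (metis box_cox_1 mem_Collect_eq zero_less_one)+
    then show ?thesis
      using True t by (simp add: add_nonpos_nonpos mult_nonneg_nonpos)
  next
    case False
    then have "z \<in> Jset W" using z bounds(2)[of z] by (simp add: Jset_def)
    then have "box_cox r (W u) \<le> box_cox r (W z) + rate z * (u - z)" if "0 < W u" for u
      using assms that unfolding tangent_bound_def by blast
    then have "(1 - t) * box_cox r (W x) + t * box_cox r (W y)
        \<le> (1 - t) * (box_cox r (W z) + rate z * (x - z)) + t * (box_cox r (W z) + rate z * (y - z))"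
      using x y t by (intro add_mono mult_left_mono) auto
    also have "\<dots> = box_cox r (W z)" by (simp add: z_def algebra_simps)
    finally show ?thesis .
  qed
  then show "- box_cox r (W ((1 - t) * x + t * y)) \<le> (1 - t) * - box_cox r (W x) + t * - box_cox r (W y)"
    by (simp add: z_def)
qed

text \<open>Add the tangent inequality at x evaluated in y to the one at y evaluated in x.\<close>

lemma antimono_rate_of_tangent_bound:
  assumes tangent_bound
  shows "antimono_on (Jset W) rate"
proof (rule monotone_onI)
  fix x y assume xy: "x \<in> Jset W" "y \<in> Jset W" "x \<le> y"
  have "box_cox r (W y) \<le> box_cox r (W x) + rate x * (y - x)"
    "box_cox r (W x) \<le> box_cox r (W y) + rate y * (x - y)"
    using assms xy JsetD unfolding tangent_bound_def by blast+
  then have "(rate y - rate x) * (y - x) \<le> 0" by (simp add: algebra_simps)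
  then show "rate y \<le> rate x"
    using xy(3) by (cases "x = y") (auto simp: mult_le_0_iff)
qed

text \<open>Inside J the mean value theorem compares chord slopes with the rate at x. A point y with
  W y = 1 lies outside J and is handled by approaching the value 1 from below.\<close>

lemma tangent_bound_of_antimono_rate:
  assumes anti: "antimono_on (Jset W) rate"
  shows tangent_bound
  unfolding tangent_bound_def
proof (intro ballI allI impI)
  fix x y assume x: "x \<in> Jset W" and y: "0 < W y"
  let ?\<psi> = "\<lambda>x. box_cox r (W x)"
  have inner: "?\<psi> v \<le> ?\<psi> x + rate x * (v - x)" if v: "v \<in> Jset W" for v
  proof -
    consider "x = v" | "x < v" | "v < x" by linarith
    then show ?thesis
    proof cases
      case 2
      have "\<exists>z>x. z < v \<and> ?\<psi> v - ?\<psi> x = (v - x) * rate z"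
        using Icc_subset_Jset[OF x v] 2 by (intro MVT2 deriv_box_cox) auto
      then obtain z where z: "x < z" "z < v" "?\<psi> v - ?\<psi> x = (v - x) * rate z" by blast
      then have "rate z \<le> rate x"
        using Icc_subset_Jset[OF x v] by (intro monotone_onD[OF anti x]) auto
      then have "(v - x) * rate z \<le> rate x * (v - x)" using 2 by (simp add: mult.commute)
      then show ?thesis using z(3) by simp
    next
      case 3
      have "\<exists>z>v. z < x \<and> ?\<psi> x - ?\<psi> v = (x - v) * rate z"
        using Icc_subset_Jset[OF v x] 3 by (intro MVT2 deriv_box_cox) auto
      then obtain z where z: "v < z" "z < x" "?\<psi> x - ?\<psi> v = (x - v) * rate z" by blast
      then have "rate x \<le> rate z"
        using Icc_subset_Jset[OF v x] by (intro monotone_onD[OF anti _ x]) auto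
      then have "(x - v) * rate x \<le> (x - v) * rate z" using 3 by simp
      then show ?thesis using z(3) by (simp add: algebra_simps)
    qed simp
  qed
  show "?\<psi> y \<le> ?\<psi> x + rate x * (y - x)"
  proof (cases "W y = 1")
    case False
    then show ?thesis using y bounds(2)[of y] by (intro inner) (simp add: Jset_def)
  next
    case True
    have "connected (W ` closed_segment x y)"
      by (intro connected_continuous_image continuous_on_subset[OF cont]) auto
    then have ivt: "{W x..1} \<subseteq> W ` closed_segment x y"
      using True by (intro connected_contains_Icc) (auto intro: image_eqI[of _ _ y])
    \<comment> \<open>The value u is attained at some z between x and y. There the tangent line has
      risen by a fraction t of its total rise; this rise is positive because u > W x, so the line is
      at least as high at y.\<close>
    have bd: "box_cox r u \<le> ?\<psi> x + rate x * (y - x)" if u: "W x < u" "u < 1" for u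
    proof -
      obtain z where z: "z \<in> closed_segment x y" "W z = u"
        using subsetD[OF ivt, of u] u by auto
      then obtain t where t: "0 \<le> t" "t \<le> 1" "z = (1 - t) * x + t * y"
        by (auto simp: closed_segment_def)
      have zx: "z - x = t * (y - x)" by (simp add: t(3) algebra_simps)
      have "z \<in> Jset W" using u z(2) JsetD(1)[OF x] by (simp add: Jset_def)
      from inner[OF this] have le: "box_cox r u \<le> ?\<psi> x + t * (rate x * (y - x))"
        using z(2) zx by (simp add: algebra_simps)
      moreover have "?\<psi> x < box_cox r u" using box_cox_less[OF JsetD(1)[OF x] u(1)] .
      ultimately have "0 < t * (rate x * (y - x))" by simp
      then have "0 < rate x * (y - x)" using t(1) by (simp add: zero_less_mult_iff)
      then have "t * (rate x * (y - x)) \<le> rate x * (y - x)" using t by (simp add: mult_left_le_one_le)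
      then show ?thesis using le by simp
    qed
    have "isCont (box_cox r) 1" by (rule DERIV_isCont[OF has_real_derivative_box_cox]) simp
    then have "(box_cox r \<longlongrightarrow> box_cox r 1) (at_left 1)"
      by (auto simp: isCont_def intro: filterlim_mono at_le)
    then have "box_cox r 1 \<le> ?\<psi> x + rate x * (y - x)"
      using bd JsetD(2)[OF x] by (intro tendsto_upperbound[of _ _ "at_left 1"]) (auto intro!: eventually_at_leftI[of "W x"])
    then show ?thesis using True by simp
  qed
qed

lemma tangent_bound_iff_concave: "tangent_bound \<longleftrightarrow> concave_on {x. 0 < W x} (\<lambda>x. box_cox r (W x))"
  using tangent_boundI concave_on_of_tangent_bound by blast

lemma tangent_bound_iff_antimono: "tangent_bound \<longleftrightarrow> antimono_on (Jset W) rate"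
  using tangent_bound_of_antimono_rate antimono_rate_of_tangent_bound by blast

text \<open>Write w as the rate times W^(1 - r). As the rate decreases, an increment of w is at most
  \<open>rate x\<close> times the increment of W^(1 - r), which is Lipschitz on a compact part of J.
  The bound is one-sided; the other side comes from the complementary profile.\<close>

lemma slope_bound_of_antimono_rate:
  assumes anti: "antimono_on (Jset W) rate" and cd: "{c..d} \<subseteq> Jset W"
  obtains L where "0 \<le> L" "\<And>x y. c \<le> x \<Longrightarrow> x \<le> y \<Longrightarrow> y \<le> d \<Longrightarrow> w y - w x \<le> L * (y - x)"
proof (cases "c \<le> d")
  case False
  then show thesis using that[of 0] by auto
next
  case True
  define R where "R = max \<bar>rate c\<bar> \<bar>rate d\<bar>"
  have J: "x \<in> Jset W" if "x \<in> {c..d}" for x using cd that by blast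
  have R: "\<bar>rate x\<bar> \<le> R" if "x \<in> {c..d}" for x
  proof -
    have "rate x \<le> rate c" "rate d \<le> rate x"
      using that True by (auto intro!: monotone_onD[OF anti] J)
    then show ?thesis by (auto simp: R_def)
  qed
  have pw: "0 < W x powr (1 - r)" "W x powr (1 - r) \<le> 1" if "x \<in> {c..d}" for x
    using JsetD[OF J[OF that]] r_le_1 by (auto intro: powr_le1)
  have w_eq: "w x = rate x * W x powr (1 - r)" if "x \<in> {c..d}" for x
    using pw(1)[OF that] by (simp add: rate_def)
  have w_le: "\<bar>w x\<bar> \<le> R" if "x \<in> {c..d}" for x
    using mult_mono[OF R[OF that] pw(2)[OF that]] R[OF that] pw(1)[OF that]
    by (simp add: w_eq[OF that] abs_mult)
  \<comment> \<open>This power is a factor of the derivative of W^(1 - r), and compactness bounds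
    it.\<close>
  have "continuous_on {c..d} (\<lambda>x. W x powr (- r))"
    by (intro continuous_on_powr continuous_on_subset[OF cont] continuous_on_const) (use JsetD(1)[OF J] in force)+
  then have "compact ((\<lambda>x. W x powr (- r)) ` {c..d})"
    by (intro compact_continuous_image) auto
  then obtain B where "\<And>x. x \<in> {c..d} \<Longrightarrow> norm (W x powr (- r)) \<le> B"
    using compact_imp_bounded bounded_iff by (metis (no_types, lifting) imageI)
  then have B: "W x powr (- r) \<le> B" if "x \<in> {c..d}" for x using that by fastforce
  have R0: "0 \<le> R" by (simp add: R_def)
  have B0: "0 \<le> B" using order_trans[OF powr_ge_zero B[of c]] True by simp
  let ?p = "\<lambda>x. W x powr (1 - r)"
  have dp: "(?p has_real_derivative (1 - r) * W z powr (- r) * w z) (at z)" if "z \<in> {c..d}" for z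
    using DERIV_fun_powr[OF deriv[OF J[OF that]], of "1 - r"] JsetD(1)[OF J[OF that]] by simp
  have "w y - w x \<le> R * ((1 - r) * B * R) * (y - x)" if xy: "c \<le> x" "x \<le> y" "y \<le> d" for x y
  proof (cases "x = y")
    case False
    then have "x < y" using xy by simp
    have "\<exists>z>x. z < y \<and> ?p y - ?p x = (y - x) * ((1 - r) * W z powr (- r) * w z)"
      using xy by (intro MVT2 \<open>x < y\<close> dp) auto
    then obtain z where z: "x < z" "z < y" "?p y - ?p x = (y - x) * ((1 - r) * W z powr (- r) * w z)" by blast
    have zcd: "z \<in> {c..d}" using z xy by simp
    have "\<bar>(1 - r) * W z powr (- r) * w z\<bar> \<le> (1 - r) * B * R"
      using B[OF zcd] w_le[OF zcd] r_le_1 B0 R0 by (simp add: abs_mult) (intro mult_mono, auto)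
    then have "\<bar>?p y - ?p x\<bar> \<le> (y - x) * ((1 - r) * B * R)"
      unfolding z(3) abs_mult[of "y - x"] using xy by (simp add: mult_left_mono)
    then have "\<bar>rate x\<bar> * \<bar>?p y - ?p x\<bar> \<le> R * ((y - x) * ((1 - r) * B * R))"
      using R[of x] xy R0 by (intro mult_mono) auto
    then have le: "rate x * (?p y - ?p x) \<le> R * ((y - x) * ((1 - r) * B * R))"
      by (metis abs_le_D1 abs_mult)
    have "rate y \<le> rate x"
      using xy by (intro monotone_onD[OF anti] J) auto
    then have "rate y * ?p y \<le> rate x * ?p y" using pw(1)[of y] xy by (intro mult_right_mono) auto
    then have "w y - w x \<le> rate x * (?p y - ?p x)"
      using w_eq[of x] w_eq[of y] xy by (simp add: algebra_simps)
    then show ?thesis using le by (simp add: mult_ac)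
  qed simp
  moreover have "0 \<le> R * ((1 - r) * B * R)" using R0 B0 r_le_1 by simp
  ultimately show thesis using that by blast
qed

text \<open>The right derivative of the antitone rate is at most 0. By the product rule it equals
  W^(r - 1) (D - (1 - r) w^2 / W).\<close>

lemma right_derivative_bound:
  assumes anti: "antimono_on (Jset W) rate" and x: "x \<in> Jset W"
    and D: "(w has_real_derivative D) (at_right x)"
  shows "D \<le> (1 - r) * (w x)\<^sup>2 / W x"
proof -
  have W: "0 < W x" using JsetD[OF x] by simp
  have "((\<lambda>x. W x powr (r - 1)) has_real_derivative (r - 1) * W x powr (r - 1 - 1) * w x) (at_right x)"
    using DERIV_fun_powr[OF deriv[OF x] W, of "r - 1"] by (simp add: has_field_derivative_at_within)
  from DERIV_mult[OF D this]
  have "(rate has_real_derivative D * W x powr (r - 1) + (r - 1) * W x powr (r - 1 - 1) * w x * w x) (at_right x)"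
    unfolding rate_eq[abs_def] by simp
  then have lim: "((\<lambda>y. (rate y - rate x) / (y - x)) \<longlongrightarrow>
      D * W x powr (r - 1) + (r - 1) * W x powr (r - 1 - 1) * w x * w x) (at_right x)"
    unfolding has_field_derivative_iff .
  obtain e where e: "e > 0" "ball x e \<subseteq> Jset W" using open_Jset x open_contains_ball by blast
  have "\<forall>\<^sub>F y in at_right x. (rate y - rate x) / (y - x) \<le> 0"
  proof (rule eventually_at_rightI[of x "x + e"])
    fix y assume y: "y \<in> {x<..<x + e}"
    then have "y \<in> Jset W" using e(2) by (auto simp: dist_real_def)
    then have "rate y \<le> rate x" using y by (intro monotone_onD[OF anti x]) auto
    then show "(rate y - rate x) / (y - x) \<le> 0" using y by (simp add: divide_nonpos_pos)
  qed (use e in simp)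
  then have "D * W x powr (r - 1) + (r - 1) * W x powr (r - 1 - 1) * w x * w x \<le> 0"
    using tendsto_upperbound[OF lim] by simp
  moreover have "W x powr (r - 1 - 1) = W x powr (r - 1) / W x"
    using W powr_diff[of "W x" "r - 1" 1] by simp
  ultimately have "W x powr (r - 1) * (D - (1 - r) * (w x)\<^sup>2 / W x) \<le> 0"
    by (simp add: algebra_simps power2_eq_square diff_divide_distrib add_divide_distrib)
  then have "D - (1 - r) * (w x)\<^sup>2 / W x \<le> 0"
    using W by (simp add: mult_le_0_iff)
  then show ?thesis by simp
qed

text \<open>Differentiability of w is not assumed, so the right slopes of the rate are estimated by
  replacing the increment of w with its integral bound, which has a right derivative.\<close>

lemma antimono_rate_of_integral_bound:
  assumes cw: "continuous_on (Jset W) w"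
    and le: "\<And>x y. x \<in> Jset W \<Longrightarrow> y \<in> Jset W \<Longrightarrow> x \<le> y \<Longrightarrow>
      w y - w x \<le> integral {x..y} (\<lambda>z. (1 - r) * (w z)\<^sup>2 / W z)"
  shows "antimono_on (Jset W) rate"
proof (rule monotone_onI)
  fix c d assume cd: "c \<in> Jset W" "d \<in> Jset W" "c \<le> d"
  let ?u = "\<lambda>z. (1 - r) * (w z)\<^sup>2 / W z" and ?P = "\<lambda>x. W x powr (r - 1)"
  have J: "x \<in> Jset W" if "c \<le> x" "x \<le> d" for x using Icc_subset_Jset[OF cd(1,2)] that by auto
  have pos: "0 < W x" if "x \<in> Jset W" for x using JsetD that by blast
  have cJ: "continuous_on (Jset W) rate" "continuous_on (Jset W) ?u"
    unfolding rate_eq[abs_def]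
    by (intro continuous_intros cw continuous_on_subset[OF cont]; use pos in force)+
  show "rate d \<le> rate c"
  proof (rule nonincreasing_of_right_slopes[OF cd(3)])
    show "continuous_on {c..d} rate"
      using cJ(1) Icc_subset_Jset[OF cd(1,2)] continuous_on_subset by blast
    fix x e :: real assume x: "c \<le> x" "x < d" and "0 < e"
    have xJ: "x \<in> Jset W" using x by (intro J) auto
    \<comment> \<open>An upper bound for \<open>rate y - rate x\<close> that vanishes at y = x. The
      integrand \<open>?u\<close> is exactly what makes its right derivative at x equal to
      0.\<close>
    define \<Phi> where "\<Phi> = (\<lambda>y. ?P y * integral {x..y} ?u + w x * (?P y - ?P x))"
    have "continuous_on {x..d} ?u"
      using cJ(2) Icc_subset_Jset[OF xJ cd(2)] continuous_on_subset by blast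
    then have "((\<lambda>y. integral {x..y} ?u) has_real_derivative ?u x) (at x within {x..d})"
      using integral_has_vector_derivative[of x d ?u x] x by (simp add: has_real_derivative_iff_has_vector_derivative)
    then have dU: "((\<lambda>y. integral {x..y} ?u) has_real_derivative ?u x) (at_right x)"
      using x by (simp add: at_within_Icc_at_right)
    have dP: "(?P has_real_derivative (r - 1) * W x powr (r - 1 - 1) * w x) (at_right x)"
      using DERIV_fun_powr[OF deriv[OF xJ] pos[OF xJ], of "r - 1"] by (simp add: has_field_derivative_at_within)
    have "W x powr (r - 1 - 1) = W x powr (r - 1) / W x"
      using pos[OF xJ] powr_diff[of "W x" "r - 1" 1] by simp
    then have "(r - 1) * W x powr (r - 1 - 1) * w x * integral {x..x} ?u + ?u x * ?P x
        + w x * ((r - 1) * W x powr (r - 1 - 1) * w x - 0) = 0"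
      by (simp add: power2_eq_square) (simp add: algebra_simps diff_divide_distrib)
    then have "(\<Phi> has_real_derivative 0) (at_right x)"
      unfolding \<Phi>_def
      by (rule DERIV_cong[OF DERIV_add[OF DERIV_mult[OF dP dU] DERIV_cmult[OF DERIV_diff[OF dP DERIV_const]]]])
    then have "((\<lambda>y. (\<Phi> y - \<Phi> x) / (y - x)) \<longlongrightarrow> 0) (at_right x)"
      by (simp add: has_field_derivative_iff)
    then have "\<forall>\<^sub>F y in at_right x. (\<Phi> y - \<Phi> x) / (y - x) < e"
      using \<open>0 < e\<close> by (rule order_tendstoD)
    moreover have "\<forall>\<^sub>F y in at_right x. x < y \<and> y < d"
      using x by (intro eventually_at_rightI[of x d]) auto
    ultimately show "\<forall>\<^sub>F y in at_right x. rate y - rate x \<le> e * (y - x)"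
    proof eventually_elim
      case (elim y)
      have yJ: "y \<in> Jset W" using x elim by (intro J) auto
      have "rate y - rate x = ?P y * (w y - w x) + w x * (?P y - ?P x)"
        by (simp add: rate_eq algebra_simps)
      also have "\<dots> \<le> \<Phi> y"
        unfolding \<Phi>_def using le[OF xJ yJ] elim by (intro add_right_mono mult_left_mono) auto
      also have "\<dots> \<le> e * (y - x)"
        using elim by (simp add: \<Phi>_def divide_less_eq)
      finally show ?case .
    qed
  qed
qed

text \<open>The guard on t unites the two forms of (ii): it is void for r <= 0, and for r > 0 it
  describes the half-line on which W is positive.\<close>

lemma gpow_bound_iff_tangent_bound:
  "(\<forall>x\<in>Jset W. \<forall>t. (0 < r \<longrightarrow> 0 < W (x + t)) \<longrightarrow>
      ereal (W (x + t)) \<le> ereal (W x) * gpow r (w x / W x * t)) \<longleftrightarrow> tangent_bound"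
  (is "?L \<longleftrightarrow> _")
proof -
  have eq: "ereal (W (x + t)) \<le> ereal (W x) * gpow r (w x / W x * t) \<longleftrightarrow>
      (0 < W (x + t) \<longrightarrow> box_cox r (W (x + t)) \<le> box_cox r (W x) + rate x * t)"
    if "x \<in> Jset W" "0 < r \<longrightarrow> 0 < W (x + t)" for x t
    using le_mult_gpow_iff[of "W x" "W (x + t)" r "w x" t] JsetD(1) bounds(1) that
    by (simp add: rate_eq)
  show ?thesis
  proof
    assume L: ?L
    show tangent_bound
      unfolding tangent_bound_def
    proof (intro ballI allI impI)
      fix x y assume "x \<in> Jset W" "0 < W y"
      then show "box_cox r (W y) \<le> box_cox r (W x) + rate x * (y - x)"
        using eq[of x "y - x"] L[rule_format, of x "y - x"] by simp
    qed
  next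
    assume T: tangent_bound
    show ?L
    proof (intro ballI allI impI)
      fix x t assume x: "x \<in> Jset W" and pos: "0 < r \<longrightarrow> 0 < W (x + t)"
      show "ereal (W (x + t)) \<le> ereal (W x) * gpow r (w x / W x * t)"
        unfolding eq[OF x pos]
        using T[unfolded tangent_bound_def, rule_format, OF x, of "x + t"] by simp
    qed
  qed
qed

lemma antimono_rate_of_L1_bound:
  assumes cw: "continuous_on (Jset W) w"
    and g: "\<And>x y. x \<in> Jset W \<Longrightarrow> y \<in> Jset W \<Longrightarrow> x \<le> y \<Longrightarrow>
      g absolutely_integrable_on {x..y} \<and> w y - w x = integral {x..y} g"
    and ae: "AE x in lborel. x \<in> Jset W \<longrightarrow> g x \<le> (1 - r) * (w x)\<^sup>2 / W x"
  shows "antimono_on (Jset W) rate"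
proof (rule antimono_rate_of_integral_bound[OF cw])
  fix x y assume xy: "x \<in> Jset W" "y \<in> Jset W" "x \<le> y"
  let ?u = "\<lambda>z. (1 - r) * (w z)\<^sup>2 / W z"
  have sub: "{x..y} \<subseteq> Jset W" using Icc_subset_Jset xy by blast
  then have "0 < W z" if "z \<in> {x..y}" for z using JsetD that by blast
  then have "continuous_on {x..y} ?u"
    by (intro continuous_intros continuous_on_subset[OF cw sub] continuous_on_subset[OF cont]) force+
  then have u: "?u absolutely_integrable_on {x..y}"
    by (rule absolutely_integrable_continuous_real)
  have gi: "g absolutely_integrable_on {x..y}" "w y - w x = integral {x..y} g"
    using g[OF xy] by auto
  have "AE z in lebesgue. z \<in> Jset W \<longrightarrow> g z \<le> ?u z"
    using ae by (simp add: AE_completion_iff)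
  then have "AE z \<in> {x..y} in lebesgue. g z \<le> ?u z"
    by (rule eventually_mono) (use sub in blast)
  then have "(LINT z:{x..y}|lebesgue. g z) \<le> (LINT z:{x..y}|lebesgue. ?u z)"
    by (rule set_integral_mono_AE[OF gi(1) u])
  then show "w y - w x \<le> integral {x..y} ?u"
    using set_lebesgue_integral_eq_integral(2)[OF gi(1)] set_lebesgue_integral_eq_integral(2)[OF u] gi(2)
    by simp
qed

end

section \<open>F and 1 - F together\<close>

lemma Jset_one_minus: "Jset (\<lambda>x. 1 - F x) = Jset F"
  by (auto simp: Jset_def)

lemma bounded_profiles_of_distribution_function:
  assumes F: "distribution_function F" and cont: "continuous_on UNIV F" and r: "r \<le> 1"
    and deriv: "\<And>x. x \<in> Jset F \<Longrightarrow> (F has_real_derivative f x) (at x)"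
  shows "bounded_profile r F f" "bounded_profile r (\<lambda>x. 1 - F x) (\<lambda>x. - f x)"
proof -
  have m: "mono F" using F by (simp add: distribution_function_def)
  have cv: "convex {x. 0 < F x}" "convex {x. 0 < 1 - F x}"
    using monoD[OF m] unfolding is_interval_convex_1[symmetric] is_interval_1
    by (auto intro: less_le_trans le_less_trans)
  have "Jset F = {x. 0 < F x} \<inter> {x. 0 < 1 - F x}" by (auto simp: Jset_def)
  then have cJ: "convex (Jset F)" using cv by (simp add: convex_Int)
  note b = distribution_function_bounds[OF F]
  show "bounded_profile r F f"
    by unfold_locales (rule r cont b cv cJ deriv; assumption?)+
  show "bounded_profile r (\<lambda>x. 1 - F x) (\<lambda>x. - f x)"
  proof (unfold_locales, unfold Jset_one_minus)
    show "continuous_on UNIV (\<lambda>x. 1 - F x)" by (intro continuous_on_diff continuous_on_const cont)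
    show "((\<lambda>x. 1 - F x) has_real_derivative - f x) (at x)" if "x \<in> Jset F" for x
      using DERIV_diff[OF DERIV_const deriv[OF that]] by simp
  qed (use b in \<open>simp_all add: r cJ cv(2)[simplified]\<close>)
qed

text \<open>Concavity for F provides a function touching F from above. Concavity for 1 - F provides
  one touching 1 - F from above, whose complement touches F from below.\<close>

lemma differentiable_on_Jset:
  assumes cont: "continuous_on UNIV F"
    and C: "concave_on {x. 0 < F x} (\<lambda>x. box_cox r (F x))"
      "concave_on {x. 0 < 1 - F x} (\<lambda>x. box_cox r (1 - F x))"
  shows "\<exists>f. \<forall>x\<in>Jset F. (F has_real_derivative f x) (at x)"
proof -
  have "\<exists>D. (F has_real_derivative D) (at x)" if x: "x \<in> Jset F" for x
  proof -
    have o: "open {x. 0 < F x}" "open {x. 0 < 1 - F x}"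
      by (intro open_Collect_less continuous_intros cont)+
    have xs: "x \<in> {x. 0 < F x}" "x \<in> {x. 0 < 1 - F x}" using x by (auto simp: Jset_def)
    obtain A a where A: "(A has_real_derivative a) (at x)" "A x = F x" "\<forall>\<^sub>F y in nhds x. F y \<le> A y"
      using box_cox_concave_upper_touch[OF C(1) o(1) xs(1)] by auto
    obtain B b where B: "(B has_real_derivative b) (at x)" "B x = 1 - F x" "\<forall>\<^sub>F y in nhds x. 1 - F y \<le> B y"
      using box_cox_concave_upper_touch[OF C(2) o(2) xs(2)] by auto
    have "(F has_real_derivative a) (at x)"
    proof (rule has_real_derivative_sandwich)
      show "((\<lambda>y. 1 - B y) has_real_derivative 0 - b) (at x)"
        by (intro DERIV_diff DERIV_const B)
      show "\<forall>\<^sub>F y in nhds x. 1 - B y \<le> F y \<and> F y \<le> A y"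
        using A(3) B(3) by eventually_elim auto
    qed (use A B in auto)
    then show ?thesis by blast
  qed
  then show ?thesis by metis
qed

locale differentiable_distribution =
  fixes F f :: "real \<Rightarrow> real" and r :: real
  assumes distr: "distribution_function F" and cont: "continuous_on UNIV F" and r_le_1: "r \<le> 1"
    and nondeg: "Jset F \<noteq> {}"
    and deriv: "\<And>x. x \<in> Jset F \<Longrightarrow> (F has_real_derivative f x) (at x)"
begin

sublocale P: bounded_profile r F f
  by (rule bounded_profiles_of_distribution_function[OF distr cont r_le_1 deriv])

sublocale Q: bounded_profile r "\<lambda>x. 1 - F x" "\<lambda>x. - f x"
  by (rule bounded_profiles_of_distribution_function[OF distr cont r_le_1 deriv])

lemma mono_F: "mono F"
  using distr by (simp add: distribution_function_def)

lemma density_nonneg: "x \<in> Jset F \<Longrightarrow> 0 \<le> f x"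
  using mono_on_imp_deriv_nonneg[OF mono_F deriv, of x] by simp

lemma antimono_Q_iff:
  "antimono_on (Jset (\<lambda>x. 1 - F x)) Q.rate \<longleftrightarrow> mono_on (Jset F) (\<lambda>x. f x / (1 - F x) powr (1 - r))"
  unfolding Jset_one_minus monotone_on_def by (simp add: Q.rate_def)

text \<open>The common form with which (ii), (iii) and (iv) are each compared; together with
  continuity it is (i).\<close>

definition concave_pair :: bool where
  "concave_pair \<longleftrightarrow> concave_on {x. 0 < F x} (\<lambda>x. box_cox r (F x)) \<and>
    concave_on {x. 0 < 1 - F x} (\<lambda>x. box_cox r (1 - F x))"

lemma concave_pair_iff_tangent: "concave_pair \<longleftrightarrow> P.tangent_bound \<and> Q.tangent_bound"
  by (simp only: concave_pair_def P.tangent_bound_iff_concave Q.tangent_bound_iff_concave)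

lemma concave_pair_iff_hazard:
  "concave_pair \<longleftrightarrow> mono_on (Jset F) (\<lambda>x. f x / (1 - F x) powr (1 - r)) \<and>
    antimono_on (Jset F) (\<lambda>x. f x / F x powr (1 - r))"
  unfolding concave_pair_iff_tangent P.tangent_bound_iff_antimono Q.tangent_bound_iff_antimono antimono_Q_iff
    P.rate_def[abs_def]
  by (rule conj_commute)

context
  assumes hazard: "mono_on (Jset F) (\<lambda>x. f x / (1 - F x) powr (1 - r))"
    "antimono_on (Jset F) (\<lambda>x. f x / F x powr (1 - r))"
begin

lemma F_powr_pos:
  assumes "x \<in> Jset F"
  shows "0 < F x powr (1 - r)" "F x powr (1 - r) \<le> 1" "0 < (1 - F x) powr (1 - r)" "(1 - F x) powr (1 - r) \<le> 1"
  using assms r_le_1 by (auto simp: Jset_def intro: powr_le1)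

text \<open>A zero of f spreads to the right by the reverse hazard function and to the left by the
  hazard function. F is then constant on J(F), which becomes a level set, both closed and open,
  hence the whole line; this contradicts the limit 0 at -infinity.\<close>

lemma density_pos:
  assumes x0: "x0 \<in> Jset F"
  shows "0 < f x0"
proof (rule ccontr)
  assume "\<not> 0 < f x0"
  then have f0: "f x0 = 0" using density_nonneg[OF x0] by simp
  have zero: "f x = 0" if x: "x \<in> Jset F" for x
  proof (cases "x0 \<le> x")
    case True
    have "f x / F x powr (1 - r) \<le> f x0 / F x0 powr (1 - r)"
      by (rule monotone_onD[OF hazard(2) x0 x True])
    then show ?thesis
      using f0 F_powr_pos(1)[OF x] density_nonneg[OF x] by (simp add: divide_le_0_iff)
  next
    case False
    have "f x / (1 - F x) powr (1 - r) \<le> f x0 / (1 - F x0) powr (1 - r)"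
      using False by (intro monotone_onD[OF hazard(1) x x0]) simp
    then show ?thesis
      using f0 F_powr_pos(3)[OF x] density_nonneg[OF x] by (simp add: divide_le_0_iff)
  qed
  have "F constant_on Jset F"
    using zero deriv
    by (intro has_field_derivative_0_imp_constant_on convex_connected P.convex_Jset P.open_Jset) force+
  then obtain k where k: "\<And>x. x \<in> Jset F \<Longrightarrow> F x = k"
    unfolding constant_on_def by blast
  have J: "Jset F = {x. F x = k}"
    using k x0 by (auto simp: Jset_def)
  have "closed (Jset F)"
    unfolding J by (intro closed_Collect_eq cont continuous_on_const)
  then have "Jset F = UNIV"
    using clopen[of "Jset F"] P.open_Jset nondeg by simp
  then have const: "F = (\<lambda>_. k)"
    using k by auto
  have "(F \<longlongrightarrow> 0) at_bot" using distr by (simp add: distribution_function_def)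
  then have "((\<lambda>_. k) \<longlongrightarrow> 0) (at_bot :: real filter)" using const by metis
  then have "k = 0" by (simp add: tendsto_const_iff)
  then show False using x0 k[OF x0] by (simp add: Jset_def)
qed

text \<open>Fix a point x0 of J(F). Since the denominators are at most 1, f is bounded by either
  hazard function: the reverse one controls it to the right of x0, the other to the left.\<close>

lemma density_bounded: "bounded (f ` Jset F)"
proof -
  obtain x0 where x0: "x0 \<in> Jset F" using nondeg by blast
  let ?A = "f x0 / F x0 powr (1 - r)" and ?B = "f x0 / (1 - F x0) powr (1 - r)"
  have "norm (f x) \<le> max ?A ?B" if x: "x \<in> Jset F" for x
  proof (cases "x0 \<le> x")
    case True
    have le: "f x / F x powr (1 - r) \<le> ?A"
      by (rule monotone_onD[OF hazard(2) x0 x True])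
    have "f x \<le> f x / F x powr (1 - r)"
      using F_powr_pos(1,2)[OF x] density_nonneg[OF x]
      by (simp add: pos_le_divide_eq mult_right_le_one_le)
    then show ?thesis using le density_nonneg[OF x] by simp
  next
    case False
    then have le: "f x / (1 - F x) powr (1 - r) \<le> ?B"
      by (intro monotone_onD[OF hazard(1) x x0]) simp
    have "f x \<le> f x / (1 - F x) powr (1 - r)"
      using F_powr_pos(3,4)[OF x] density_nonneg[OF x]
      by (simp add: pos_le_divide_eq mult_right_le_one_le)
    then show ?thesis using le density_nonneg[OF x] by simp
  qed
  then show ?thesis by (auto simp: bounded_iff)
qed

lemma antimono_rates: "antimono_on (Jset F) P.rate" "antimono_on (Jset (\<lambda>x. 1 - F x)) Q.rate"
  unfolding antimono_Q_iff P.rate_def[abs_def] by (rule hazard)+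

text \<open>The profile F bounds the growth of f and the profile 1 - F bounds its decline.\<close>

lemma density_lipschitz_on_Icc:
  assumes "{c..d} \<subseteq> Jset F"
  shows "\<exists>L. L-lipschitz_on {c..d} f"
proof -
  obtain L where L: "0 \<le> L" "\<And>x y. c \<le> x \<Longrightarrow> x \<le> y \<Longrightarrow> y \<le> d \<Longrightarrow> f y - f x \<le> L * (y - x)"
    using P.slope_bound_of_antimono_rate[OF antimono_rates(1) assms] by metis
  have "{c..d} \<subseteq> Jset (\<lambda>x. 1 - F x)" using assms unfolding Jset_one_minus .
  from Q.slope_bound_of_antimono_rate[OF antimono_rates(2) this]
  obtain K where K: "0 \<le> K" "\<And>x y. c \<le> x \<Longrightarrow> x \<le> y \<Longrightarrow> y \<le> d \<Longrightarrow> - f y - - f x \<le> K * (y - x)"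
    by metis
  have "(max L K)-lipschitz_on {c..d} f"
  proof (rule lipschitz_on_leI)
    fix x y assume xy: "x \<in> {c..d}" "y \<in> {c..d}" "x \<le> y"
    then have "f y - f x \<le> L * (y - x)" "f x - f y \<le> K * (y - x)"
      using L(2)[of x y] K(2)[of x y] by auto
    moreover have "L * (y - x) \<le> max L K * (y - x)" "K * (y - x) \<le> max L K * (y - x)"
      using xy(3) by (auto intro!: mult_right_mono)
    ultimately show "dist (f x) (f y) \<le> max L K * dist x y"
      using xy(3) by (simp add: dist_real_def)
  qed (use L in simp)
  then show ?thesis by blast
qed

lemma density_locally_lipschitz:
  assumes "x \<in> Jset F"
  shows "\<exists>e>0. \<exists>L. L-lipschitz_on (cball x e \<inter> Jset F) f"
proof -
  obtain e where e: "e > 0" "cball x e \<subseteq> Jset F"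
    using P.open_Jset assms open_contains_cball by blast
  moreover have "cball x e = {x - e..x + e}" by (auto simp: dist_real_def)
  ultimately obtain L where "L-lipschitz_on (cball x e) f"
    using density_lipschitz_on_Icc[of "x - e" "x + e"] by auto
  then have "L-lipschitz_on (cball x e \<inter> Jset F) f" by (rule lipschitz_on_subset) simp
  then show ?thesis using e(1) by blast
qed

lemma density_L1_derivative:
  obtains f' where
    "\<forall>x\<in>Jset F. \<forall>y\<in>Jset F. x \<le> y \<longrightarrow> f' absolutely_integrable_on {x..y} \<and> f y - f x = integral {x..y} f'"
    "AE x in lborel. x \<in> Jset F \<longrightarrow>
       - (1 - r) * (f x)\<^sup>2 / (1 - F x) \<le> f' x \<and> f' x \<le> (1 - r) * (f x)\<^sup>2 / F x"
proof -
  have "is_interval (Jset F)" using P.convex_Jset by (simp add: is_interval_convex_1)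
  with P.open_Jset obtain f' where f':
    "\<And>x y. x \<in> Jset F \<Longrightarrow> y \<in> Jset F \<Longrightarrow> x \<le> y \<Longrightarrow> f' absolutely_integrable_on {x..y} \<and> f y - f x = integral {x..y} f'"
    "AE x in lborel. x \<in> Jset F \<longrightarrow> (f has_real_derivative f' x) (at_right x)"
    using locally_lipschitz_L1_derivative[OF _ _ density_lipschitz_on_Icc] by blast
  show thesis
  proof
    show "\<forall>x\<in>Jset F. \<forall>y\<in>Jset F. x \<le> y \<longrightarrow> f' absolutely_integrable_on {x..y} \<and> f y - f x = integral {x..y} f'"
      using f'(1) by simp
    show "AE x in lborel. x \<in> Jset F \<longrightarrow>
       - (1 - r) * (f x)\<^sup>2 / (1 - F x) \<le> f' x \<and> f' x \<le> (1 - r) * (f x)\<^sup>2 / F x"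
    proof (rule eventually_mono[OF f'(2)], intro impI)
      fix x assume "x \<in> Jset F \<longrightarrow> (f has_real_derivative f' x) (at_right x)" and x: "x \<in> Jset F"
      then have d: "(f has_real_derivative f' x) (at_right x)" by blast
      have "f' x \<le> (1 - r) * (f x)\<^sup>2 / F x"
        by (rule P.right_derivative_bound[OF antimono_rates(1) x d])
      moreover have "- f' x \<le> (1 - r) * (- f x)\<^sup>2 / (1 - F x)"
        by (rule Q.right_derivative_bound[OF antimono_rates(2) _ DERIV_minus[OF d]]) (simp add: x Jset_one_minus)
      then have "- (1 - r) * (f x)\<^sup>2 / (1 - F x) \<le> f' x"
        by (simp only: power2_minus mult_minus_left minus_divide_left[symmetric] minus_le_iff)
      ultimately show "- (1 - r) * (f x)\<^sup>2 / (1 - F x) \<le> f' x \<and> f' x \<le> (1 - r) * (f x)\<^sup>2 / F x" by blast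
    qed
  qed
qed

end

text \<open>In the converse the local Lipschitz condition supplies continuity of f, and the
  integrated bounds on f' and on -f' make the rates of F and of 1 - F antitone.\<close>

lemma concave_pair_iff_density:
  "concave_pair \<longleftrightarrow>
    bounded (f ` Jset F) \<and> (\<forall>x\<in>Jset F. 0 < f x) \<and>
    (\<forall>x\<in>Jset F. \<exists>e>0. \<exists>L. L-lipschitz_on (cball x e \<inter> Jset F) f) \<and>
    (\<exists>f'. (\<forall>x\<in>Jset F. \<forall>y\<in>Jset F. x \<le> y \<longrightarrow>
              f' absolutely_integrable_on {x..y} \<and> f y - f x = integral {x..y} f') \<and>
          (AE x in lborel. x \<in> Jset F \<longrightarrow>
              - (1 - r) * (f x)\<^sup>2 / (1 - F x) \<le> f' x \<and>
              f' x \<le> (1 - r) * (f x)\<^sup>2 / F x))"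
  (is "_ \<longleftrightarrow> ?bd \<and> ?pos \<and> ?lip \<and> (\<exists>f'. ?ftc f' \<and> ?ae f')")
proof
  assume concave_pair
  then have hz: "mono_on (Jset F) (\<lambda>x. f x / (1 - F x) powr (1 - r))"
    "antimono_on (Jset F) (\<lambda>x. f x / F x powr (1 - r))"
    by (auto simp: concave_pair_iff_hazard)
  have "\<exists>f'. ?ftc f' \<and> ?ae f'"
    by (rule density_L1_derivative[OF hz]) (intro exI conjI)
  then show "?bd \<and> ?pos \<and> ?lip \<and> (\<exists>f'. ?ftc f' \<and> ?ae f')"
    by (intro conjI ballI density_bounded[OF hz] density_pos[OF hz] density_locally_lipschitz[OF hz])
next
  assume R: "?bd \<and> ?pos \<and> ?lip \<and> (\<exists>f'. ?ftc f' \<and> ?ae f')"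
  then obtain f' where f': "?ftc f'" "?ae f'" by blast
  have cf: "continuous_on (Jset F) f"
  proof (rule continuous_at_imp_continuous_on, intro ballI)
    fix x assume x: "x \<in> Jset F"
    then obtain e L where e: "e > 0" "L-lipschitz_on (cball x e \<inter> Jset F) f" using R by blast
    then have c: "continuous_on (cball x e \<inter> Jset F) f" by (intro lipschitz_on_continuous_on)
    have "x \<in> interior (cball x e \<inter> Jset F)"
      using e(1) x P.open_Jset by (simp add: interior_Int interior_open interior_cball)
    then show "isCont f x" using c continuous_on_interior by blast
  qed
  have "antimono_on (Jset F) P.rate"
    using f' by (intro P.antimono_rate_of_L1_bound[OF cf, of f']) (auto elim: eventually_mono)
  moreover have "antimono_on (Jset (\<lambda>x. 1 - F x)) Q.rate"
  proof (rule Q.antimono_rate_of_L1_bound[of "\<lambda>x. - f' x"], unfold Jset_one_minus)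
    show "continuous_on (Jset F) (\<lambda>x. - f x)" by (intro continuous_on_minus cf)
    show "(\<lambda>x. - f' x) absolutely_integrable_on {x..y} \<and> - f y - - f x = integral {x..y} (\<lambda>x. - f' x)"
      if xy: "x \<in> Jset F" "y \<in> Jset F" "x \<le> y" for x y
    proof -
      have 1: "f' absolutely_integrable_on {x..y}" "f y - f x = integral {x..y} f'"
        using f'(1) xy by blast+
      have "(\<lambda>x. - f' x) absolutely_integrable_on {x..y}"
        using set_integrable_mult_right[OF 1(1), of "-1"] by simp
      then show ?thesis using 1(2) by simp
    qed
    show "AE x in lborel. x \<in> Jset F \<longrightarrow> - f' x \<le> (1 - r) * (- f x)\<^sup>2 / (1 - F x)"
      using f'(2) by (rule eventually_mono) (auto simp: minus_le_iff simp del: minus_diff_eq)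
  qed
  ultimately show concave_pair
    unfolding concave_pair_iff_tangent P.tangent_bound_iff_antimono Q.tangent_bound_iff_antimono by blast
qed

lemma concave_pair_iff_gpow:
  "concave_pair \<longleftrightarrow> (\<forall>x\<in>Jset F.
     (\<forall>t. (0 < r \<longrightarrow> 0 < F (x + t)) \<longrightarrow>
        ereal (F (x + t)) \<le> ereal (F x) * gpow r (f x / F x * t)) \<and>
     (\<forall>t. (0 < r \<longrightarrow> 0 < 1 - F (x + t)) \<longrightarrow>
        1 - ereal (1 - F x) * gpow r (- (f x / (1 - F x)) * t) \<le> ereal (F (x + t))))"
  unfolding concave_pair_iff_tangent P.gpow_bound_iff_tangent_bound[symmetric]
    Q.gpow_bound_iff_tangent_bound[symmetric] Jset_one_minus one_minus_le_ereal_iff minus_divide_left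
  by blast

end

section \<open>The four equivalent statements\<close>

theorem theorem2:
  fixes s :: ereal and F :: "real \<Rightarrow> real"
  assumes s_range: "-1 < s"
    and distr: "distribution_function F"
    and nondeg: "Jset F \<noteq> {}"
  defines "a \<equiv> Inf (ereal ` Jset F)" and "b \<equiv> Sup (ereal ` Jset F)"
  shows
   "(bi_sconcave s F \<longleftrightarrow>
      (continuous_on UNIV F \<and>
       (\<exists>f. (\<forall>x\<in>Jset F. (F has_real_derivative f x) (at x)) \<and>
         (if s \<le> 0 then
            (\<forall>x\<in>Jset F. \<forall>t.
               ereal (F (x + t)) \<le> ereal (F x) * gpow (sstar s) (f x / F x * t) \<and>
               1 - ereal (1 - F x) * gpow (sstar s) (- (f x / (1 - F x)) * t) \<le> ereal (F (x + t)))
          else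
            (\<forall>x\<in>Jset F.
               (\<forall>t. a < ereal (x + t) \<longrightarrow>
                  ereal (F (x + t)) \<le> ereal (F x) * gpow (sstar s) (f x / F x * t)) \<and>
               (\<forall>t. ereal (x + t) < b \<longrightarrow>
                  1 - ereal (1 - F x) * gpow (sstar s) (- (f x / (1 - F x)) * t) \<le> ereal (F (x + t))))))))
    \<and> (bi_sconcave s F \<longleftrightarrow>
      (continuous_on UNIV F \<and>
       (\<exists>f. (\<forall>x\<in>Jset F. (F has_real_derivative f x) (at x)) \<and>
         mono_on (Jset F) (\<lambda>x. f x / ((1 - F x) powr (1 - sstar s))) \<and>
         antimono_on (Jset F) (\<lambda>x. f x / (F x powr (1 - sstar s))))))
    \<and> (bi_sconcave s F \<longleftrightarrow>
      (continuous_on UNIV F \<and>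
       (\<exists>f. (\<forall>x\<in>Jset F. (F has_real_derivative f x) (at x)) \<and>
         bounded (f ` Jset F) \<and> (\<forall>x\<in>Jset F. 0 < f x) \<and>
         (\<forall>x\<in>Jset F. \<exists>e>0. \<exists>L. L-lipschitz_on (cball x e \<inter> Jset F) f) \<and>
         (\<exists>f'. (\<forall>x\<in>Jset F. \<forall>y\<in>Jset F. x \<le> y \<longrightarrow>
                   f' absolutely_integrable_on {x..y} \<and> f y - f x = integral {x..y} f') \<and>
               (AE x in lborel. x \<in> Jset F \<longrightarrow>
                   - (1 - sstar s) * (f x)\<^sup>2 / (1 - F x) \<le> f' x \<and>
                   f' x \<le> (1 - sstar s) * (f x)\<^sup>2 / F x)))))"
proof -
  let ?r = "sstar s"
  let ?C = "concave_on {x. 0 < F x} (\<lambda>x. box_cox ?r (F x)) \<and>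
    concave_on {x. 0 < 1 - F x} (\<lambda>x. box_cox ?r (1 - F x))"
  have m: "mono F" using distr by (simp add: distribution_function_def)
  \<comment> \<open>All three equivalences have this shape. It suffices to match the condition X on
    a given derivative with the concavity of both transforms, since that concavity already yields a
    derivative.\<close>
  have iff: "bi_sconcave s F \<longleftrightarrow>
      continuous_on UNIV F \<and> (\<exists>f. (\<forall>x\<in>Jset F. (F has_real_derivative f x) (at x)) \<and> X f)"
    if "\<And>f. differentiable_distribution F f ?r \<Longrightarrow> X f \<longleftrightarrow> ?C" for X
  proof -
    have X: "X f \<longleftrightarrow> ?C"
      if "continuous_on UNIV F" "\<forall>x\<in>Jset F. (F has_real_derivative f x) (at x)" for f
      using \<open>\<And>f. differentiable_distribution F f ?r \<Longrightarrow> X f \<longleftrightarrow> ?C\<close>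
        distr that sstar_sgn(3)[OF s_range] nondeg
      by (simp add: differentiable_distribution_def)
    show ?thesis
      unfolding bi_sconcave_iff[OF s_range distr nondeg]
      using X differentiable_on_Jset[of F ?r] by blast
  qed
  have ii: "(if s \<le> 0 then
            (\<forall>x\<in>Jset F. \<forall>t.
               ereal (F (x + t)) \<le> ereal (F x) * gpow ?r (f x / F x * t) \<and>
               1 - ereal (1 - F x) * gpow ?r (- (f x / (1 - F x)) * t) \<le> ereal (F (x + t)))
          else
            (\<forall>x\<in>Jset F.
               (\<forall>t. a < ereal (x + t) \<longrightarrow>
                  ereal (F (x + t)) \<le> ereal (F x) * gpow ?r (f x / F x * t)) \<and>
               (\<forall>t. ereal (x + t) < b \<longrightarrow>
                  1 - ereal (1 - F x) * gpow ?r (- (f x / (1 - F x)) * t) \<le> ereal (F (x + t))))) \<longleftrightarrow> ?C"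
    if "differentiable_distribution F f ?r" for f
  proof -
    interpret differentiable_distribution F f ?r by (rule that)
    \<comment> \<open>Together with the sign of \<open>sstar s\<close>, this rewrites both branches
      on s into the guarded form of \<open>concave_pair_iff_gpow\<close>.\<close>
    have ab: "a < ereal y \<longleftrightarrow> 0 < F y" "ereal y < b \<longleftrightarrow> 0 < 1 - F y" for y
      using Jset_endpoints[OF m cont nondeg] unfolding a_def b_def by blast+
    have r: "0 < ?r \<longleftrightarrow> \<not> s \<le> 0"
      using sstar_sgn[OF s_range] by (cases s "0 :: ereal" rule: linorder_cases) auto
    show ?thesis
      unfolding concave_pair_def[symmetric] concave_pair_iff_gpow ab r by (cases "s \<le> 0") auto
  qed
  show ?thesis
  proof (intro conjI iff, goal_cases)
    case (1 f) then show ?case by (rule ii)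
  next
    case (2 f)
    then interpret differentiable_distribution F f ?r .
    show ?case using concave_pair_iff_hazard by (simp add: concave_pair_def)
  next
    case (3 f)
    then interpret differentiable_distribution F f ?r .
    show ?case using concave_pair_iff_density by (simp only: concave_pair_def)
  qed
qed

end
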